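(* Strong Clique Partition Existence (a.k.a. Localizability) is solvable in polynomial time in the class of subcubic graphs.
   Context: A strong clique in a graph is a clique intersecting every maximal independent set. Strong Clique Partition Existence (a.k.a. Localizability): given a graph $G$, can the vertex set of $G$ be partitioned into strong cliques? A graph is subcubic if its maximum degree is at most 3. *)

theory Defs
  imports
    Main
    "HOL-Library.Ramsey"
    "HOL-Library.Disjoint_Sets"
    "HOL-Computational_Algebra.Polynomial"
begin

section \<open>Graphs and strong cliques\<close>

text \<open>A graph is given by a vertex set and a set of two-element edges, matching
  \<^const>\<open>clique\<close> and \<^const>\<open>indep\<close> of the library.\<close>

definition simple_graph :: "'a set \<Rightarrow> 'a set set \<Rightarrow> bool" where
  "simple_graph V E \<longleftrightarrow> finite V \<and> (\<forall>e\<in>E. e \<subseteq> V \<and> card e = 2)"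

definition vertex_degree :: "'a set set \<Rightarrow> 'a \<Rightarrow> nat" where
  "vertex_degree E v = card {e \<in> E. v \<in> e}"

definition subcubic :: "'a set \<Rightarrow> 'a set set \<Rightarrow> bool" where
  "subcubic V E \<longleftrightarrow> (\<forall>v\<in>V. vertex_degree E v \<le> 3)"

definition maximal_indep :: "'a set \<Rightarrow> 'a set set \<Rightarrow> 'a set \<Rightarrow> bool" where
  "maximal_indep V E I \<longleftrightarrow>
     I \<subseteq> V \<and> indep I E \<and> (\<forall>J. I \<subset> J \<and> J \<subseteq> V \<longrightarrow> \<not> indep J E)"

definition strong_clique :: "'a set \<Rightarrow> 'a set set \<Rightarrow> 'a set \<Rightarrow> bool" where
  "strong_clique V E C \<longleftrightarrow>
     C \<subseteq> V \<and> clique C E \<and> (\<forall>I. maximal_indep V E I \<longrightarrow> C \<inter> I \<noteq> {})"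

definition localizable :: "'a set \<Rightarrow> 'a set set \<Rightarrow> bool" where
  "localizable V E \<longleftrightarrow> (\<exists>P. partition_on V P \<and> (\<forall>C\<in>P. strong_clique V E C))"

text \<open>The input string for a graph on the vertices \<open>0, \<dots>, n - 1\<close> is its adjacency
  matrix, row by row; its length is \<open>n * n\<close>.\<close>

definition adjacency_string :: "nat \<Rightarrow> nat set set \<Rightarrow> bool list" where
  "adjacency_string n E = concat (map (\<lambda>u. map (\<lambda>v. {u, v} \<in> E) [0..<n]) [0..<n])"


section \<open>Deterministic multi-tape Turing machines\<close>

text \<open>States and tape symbols are natural numbers below the respective bounds.
  Given the current state and the list of symbols under the heads, the transition function
  yields the next state and, for each tape, the symbol to write and the head movement.
  Only its values on the finitely many arguments within the bounds matter.\<close>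

datatype direction = Move_Left | Stay | Move_Right

record tm =
  num_tapes :: nat
  num_symbols :: nat
  num_states :: nat
  initial :: nat
  accepting :: nat
  rejecting :: nat
  transition :: "nat \<Rightarrow> nat list \<Rightarrow> nat \<times> (nat \<times> direction) list"

definition blank_symbol :: nat where "blank_symbol = 0"
definition start_symbol :: nat where "start_symbol = 1"
definition bit_symbol :: "bool \<Rightarrow> nat" where "bit_symbol b = (if b then 3 else 2)"

definition well_formed_tm :: "tm \<Rightarrow> bool" where
  "well_formed_tm M \<longleftrightarrow>
     1 \<le> num_tapes M \<and> 4 \<le> num_symbols M \<and>
     initial M < num_states M \<and> accepting M < num_states M \<and> rejecting M < num_states M \<and>
     accepting M \<noteq> rejecting M \<and>
     (\<forall>q xs. q < num_states M \<and> length xs = num_tapes M \<and> (\<forall>x\<in>set xs. x < num_symbols M) \<longrightarrow>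
        (case transition M q xs of (q', acts) \<Rightarrow>
           q' < num_states M \<and> length acts = num_tapes M \<and>
           (\<forall>(y, d)\<in>set acts. y < num_symbols M)))"

text \<open>A tape is infinite to the right only and comes with its head position. A head on
  cell \<open>0\<close> that is told to move left stays there, by truncated subtraction.\<close>

type_synonym tape = "(nat \<Rightarrow> nat) \<times> nat"

definition read_tape :: "tape \<Rightarrow> nat" where
  "read_tape = (\<lambda>(f, i). f i)"

definition act_tape :: "nat \<times> direction \<Rightarrow> tape \<Rightarrow> tape" where
  "act_tape = (\<lambda>(y, d) (f, i).
     (f(i := y), case d of Move_Left \<Rightarrow> i - 1 | Stay \<Rightarrow> i | Move_Right \<Rightarrow> i + 1))"

text \<open>The accepting and the rejecting state are halting: the configuration no longer changes.\<close>

definition tm_step :: "tm \<Rightarrow> nat \<times> tape list \<Rightarrow> nat \<times> tape list" where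
  "tm_step M = (\<lambda>(q, tps).
     if q = accepting M \<or> q = rejecting M then (q, tps)
     else case transition M q (map read_tape tps) of
       (q', acts) \<Rightarrow> (q', map2 act_tape acts tps))"

text \<open>Cell \<open>0\<close> initially carries the start symbol, the cells after it the given word.\<close>

definition initial_tape :: "bool list \<Rightarrow> tape" where
  "initial_tape w =
     ((\<lambda>i. if i = 0 then start_symbol
           else if i \<le> length w then bit_symbol (w ! (i - 1))
           else blank_symbol), 0)"

definition initial_config :: "tm \<Rightarrow> bool list \<Rightarrow> nat \<times> tape list" where
  "initial_config M w =
     (initial M, initial_tape w # replicate (num_tapes M - 1) (initial_tape []))"

definition state_after :: "tm \<Rightarrow> bool list \<Rightarrow> nat \<Rightarrow> nat" where
  "state_after M w t = fst ((tm_step M ^^ t) (initial_config M w))"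

text \<open>The decision problem \<open>Q\<close> restricted to the class \<open>I\<close> of instances, which are presented
  to the machine via the encoding \<open>enc\<close>. As usual for problems restricted to a class of
  inputs, nothing is required of the machine on words that do not encode a member of \<open>I\<close>.\<close>

definition poly_time_solvable_on :: "'i set \<Rightarrow> ('i \<Rightarrow> bool list) \<Rightarrow> ('i \<Rightarrow> bool) \<Rightarrow> bool" where
  "poly_time_solvable_on I enc Q \<longleftrightarrow>
     (\<exists>M (p :: nat poly). well_formed_tm M \<and>
        (\<forall>x\<in>I. \<exists>t \<le> poly p (length (enc x)).
           state_after M (enc x) t = (if Q x then accepting M else rejecting M)))"

end

theory Submission
  imports Defs
begin

text \<open>A clique is strong iff no independent set disjoint from it dominates it. If two strong cliques
  of a subcubic graph intersect, then either they differ by a swap of two vertices with the same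
  neighbourhood, or they are an edge and a triangle; if the graph is localizable, the latter happens
  only in components with five vertices. It follows that in a localizable subcubic graph every
  inclusion-maximal family of disjoint strong cliques is a partition. Conversely, a maximal family
  that misses a vertex \<open>v\<close> is witnessed by its at most three members that meet the neighbourhood of
  \<open>v\<close>. So localizability of subcubic graphs is a fixed first-order property of the adjacency
  relation, and such a property is decided in polynomial time by running through all values of the
  quantified variables.\<close>

section \<open>Strong cliques in subcubic graphs\<close>

text \<open>Two obstacles shape the proof. A partition has unboundedly many members, so no formula
  quantifying over vertices can name it; and strong cliques may overlap, so a greedy choice might
  get stuck. Overlaps turn out to be harmless by alternating between a given partition and a
  disjoint family that blocks every strong clique around \<open>v\<close>. The partition clique at
  \<open>v\<close> is blocked by a member of the family with a twin of \<open>v\<close> in place of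
  \<open>v\<close>. The partition clique of that twin, with \<open>v\<close> put in its place, is
  strong again and is blocked by a member with a further twin, and so on. Three rounds give four
  vertices with a common neighbour. All that has to be named is small by the degree bound: a clique
  has at most 4 vertices, at most 3 disjoint cliques meet a neighbourhood, and an independent set
  dominating a clique can be thinned to one neighbour per vertex of it. The count of variables is 1
  + 3 * 4 + 4 + 4 = 21: a vertex, three cliques, a clique and a set dominating it.\<close>

definition nbs :: "'a set set \<Rightarrow> 'a \<Rightarrow> 'a set" where
  "nbs E v = {u. {u, v} \<in> E}"

lemma nbs_sym: "u \<in> nbs E v \<longleftrightarrow> v \<in> nbs E u"
  by (simp add: nbs_def insert_commute)

lemma card_2_elem:
  assumes "card A = 2" "k \<in> A"
  obtains v where "A = {k, v}" "v \<noteq> k"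
proof -
  obtain p q where A: "A = {p, q}" "p \<noteq> q" using assms(1) by (auto simp: card_2_iff)
  show ?thesis
  proof (cases "k = p")
    case True
    with A that[of q] show ?thesis by auto
  next
    case False
    with A that[of p] assms(2) show ?thesis by auto
  qed
qed

locale subcubic_graph =
  fixes V :: "'a set" and E :: "'a set set"
  assumes simple: "simple_graph V E" and subcubic: "subcubic V E"
begin

abbreviation N :: "'a \<Rightarrow> 'a set" where "N \<equiv> nbs E"
abbreviation strong :: "'a set \<Rightarrow> bool" where "strong \<equiv> strong_clique V E"

lemma finite_V: "finite V"
  using simple by (simp add: simple_graph_def)

lemma N_subset: "N v \<subseteq> V"
  using simple by (auto simp: nbs_def simple_graph_def)

lemma N_imp_V: "u \<in> N v \<Longrightarrow> v \<in> V"
  using N_subset nbs_sym by (metis subsetD)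

lemma finite_N: "finite (N v)"
  using N_subset finite_V finite_subset by blast

lemma N_irrefl: "v \<notin> N v"
  using simple by (auto simp: nbs_def simple_graph_def)

lemma card_N: "card (N v) \<le> 3"
proof (cases "v \<in> V")
  case True
  have "finite E"
    using simple finite_V by (auto simp: simple_graph_def intro: finite_subset[of E "Pow V"])
  moreover have "inj_on (\<lambda>u. {u, v}) (N v)"
    by (auto simp: inj_on_def doubleton_eq_iff)
  ultimately have "card (N v) \<le> card {e \<in> E. v \<in> e}"
    by (intro card_inj_on_le[where f = "\<lambda>u. {u, v}"]) (auto simp: nbs_def)
  with True subcubic show ?thesis by (fastforce simp: subcubic_def vertex_degree_def)
next
  case False
  then have "N v = {}" using N_imp_V by blast
  then show ?thesis by simp
qed

lemma N_eq: "A \<subseteq> N v \<Longrightarrow> card A = 3 \<Longrightarrow> N v = A"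
  using card_N[of v] finite_N by (metis card_seteq)

section \<open>Independent sets, cliques and the test for strength\<close>

lemma indep_iff: "indep I E \<longleftrightarrow> (\<forall>u\<in>I. \<forall>v\<in>I. u \<notin> N v)"
proof
  assume I: "indep I E"
  show "\<forall>u\<in>I. \<forall>v\<in>I. u \<notin> N v"
  proof (intro ballI)
    fix u v assume "u \<in> I" "v \<in> I"
    with I show "u \<notin> N v"
      using N_irrefl[of v] by (cases "u = v") (simp_all add: indep_def nbs_def)
  qed
next
  assume "\<forall>u\<in>I. \<forall>v\<in>I. u \<notin> N v"
  then show "indep I E" by (simp add: indep_def nbs_def)
qed

lemma clique_iff: "clique C E \<longleftrightarrow> (\<forall>u\<in>C. \<forall>v\<in>C. u \<noteq> v \<longrightarrow> u \<in> N v)"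
  by (auto simp: clique_def nbs_def)

lemma extend_indep:
  assumes "I \<subseteq> V" "indep I E"
  obtains J where "I \<subseteq> J" "maximal_indep V E J"
proof -
  let ?S = "{J. I \<subseteq> J \<and> J \<subseteq> V \<and> indep J E}"
  have "finite ?S" using finite_V by (auto intro: finite_subset[of _ "Pow V"])
  moreover have "I \<in> ?S" using assms by simp
  ultimately obtain J where "J \<in> ?S" and max: "\<forall>K\<in>?S. J \<subseteq> K \<longrightarrow> J = K"
    using finite_has_maximal[of ?S] by blast
  moreover have "maximal_indep V E J"
    unfolding maximal_indep_def
  proof (intro conjI allI impI)
    fix K assume "J \<subset> K \<and> K \<subseteq> V"
    then show "\<not> indep K E" using max \<open>J \<in> ?S\<close> by auto
  qed (use \<open>J \<in> ?S\<close> in auto)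
  ultimately show ?thesis using that by blast
qed

lemma maximal_indepD:
  assumes "maximal_indep V E J"
  shows "indep J E" "\<And>x. x \<in> V \<Longrightarrow> x \<notin> J \<Longrightarrow> J \<inter> N x \<noteq> {}"
proof -
  note max = assms[unfolded maximal_indep_def]
  have J: "J \<subseteq> V" by (rule max[THEN conjunct1])
  show I: "indep J E" by (rule max[THEN conjunct2, THEN conjunct1])
  fix x assume x: "x \<in> V" "x \<notin> J"
  show "J \<inter> N x \<noteq> {}"
  proof
    assume "J \<inter> N x = {}"
    then have "\<forall>u\<in>J. u \<notin> N x \<and> x \<notin> N u" using nbs_sym[of x E] by auto
    then have "indep (insert x J) E" using I N_irrefl by (simp add: indep_iff)
    moreover have "J \<subset> insert x J \<and> insert x J \<subseteq> V" using x J by blast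
    then have "\<not> indep (insert x J) E" by (rule max[THEN conjunct2, THEN conjunct2, rule_format])
    ultimately show False by simp
  qed
qed

text \<open>A maximal independent set that misses \<open>C\<close> must contain a neighbour of every
  vertex of \<open>C\<close>; conversely, an independent set with such neighbours still keeps out
  all of \<open>C\<close> after extension to a maximal one. The criterion needs only one neighbour
  per vertex of \<open>C\<close>, so its failure has a bounded witness.\<close>

lemma strong_iff:
  "strong C \<longleftrightarrow> C \<subseteq> V \<and> clique C E \<and>
     \<not> (\<exists>I. indep I E \<and> I \<inter> C = {} \<and> (\<forall>c\<in>C. I \<inter> N c \<noteq> {}))"
proof (intro iffI)
  assume C: "strong C"
  have "\<not> (\<exists>I. indep I E \<and> I \<inter> C = {} \<and> (\<forall>c\<in>C. I \<inter> N c \<noteq> {}))"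
  proof
    assume "\<exists>I. indep I E \<and> I \<inter> C = {} \<and> (\<forall>c\<in>C. I \<inter> N c \<noteq> {})"
    then obtain I where I: "indep I E" "I \<inter> C = {}" "\<forall>c\<in>C. I \<inter> N c \<noteq> {}" by blast
    \<comment> \<open>\<open>I\<close> need not lie in \<open>V\<close>, but all neighbours do, so
      cutting it down to \<open>V\<close> keeps it dominating.\<close>
    have "indep (I \<inter> V) E" using I(1) by (auto simp: indep_iff)
    then obtain J where J: "I \<inter> V \<subseteq> J" "maximal_indep V E J"
      using extend_indep[of "I \<inter> V"] by blast
    with C have "C \<inter> J \<noteq> {}" by (simp add: strong_clique_def)
    then obtain c where c: "c \<in> C" "c \<in> J" by blast
    with I(3) obtain y where "y \<in> I" "y \<in> N c" by blast
    then have "y \<in> J" using J(1) N_subset by blast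
    with maximal_indepD(1)[OF J(2)] c(2) \<open>y \<in> N c\<close> show False by (simp add: indep_iff)
  qed
  moreover have "C \<subseteq> V" "clique C E" using C by (simp_all add: strong_clique_def)
  ultimately show "C \<subseteq> V \<and> clique C E \<and>
     \<not> (\<exists>I. indep I E \<and> I \<inter> C = {} \<and> (\<forall>c\<in>C. I \<inter> N c \<noteq> {}))"
    by (intro conjI)
next
  assume C: "C \<subseteq> V \<and> clique C E \<and>
     \<not> (\<exists>I. indep I E \<and> I \<inter> C = {} \<and> (\<forall>c\<in>C. I \<inter> N c \<noteq> {}))"
  have "C \<inter> J \<noteq> {}" if J: "maximal_indep V E J" for J
  proof
    assume disj: "C \<inter> J = {}"
    have "J \<inter> N c \<noteq> {}" if "c \<in> C" for c
      using maximal_indepD(2)[OF J, of c] that C disj by blast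
    moreover have "indep J E" "J \<inter> C = {}" using maximal_indepD(1)[OF J] disj by auto
    ultimately have "\<exists>I. indep I E \<and> I \<inter> C = {} \<and> (\<forall>c\<in>C. I \<inter> N c \<noteq> {})" by blast
    with C show False by blast
  qed
  with C show "strong C" by (simp add: strong_clique_def)
qed

section \<open>Consequences of strength: maximality, size, twins, overlaps\<close>

lemma not_dominated:
  "strong C \<Longrightarrow> indep I E \<Longrightarrow> I \<inter> C = {} \<Longrightarrow> \<exists>c\<in>C. I \<inter> N c = {}"
  unfolding strong_iff by meson

text \<open>A vertex adjacent to all of \<open>C\<close> would lie outside \<open>C\<close> and form
  an independent dominating set by itself. Many contradictions below are reached by exhibiting such
  a vertex.\<close>

lemma strong_maximal:
  assumes "strong C" shows "\<exists>c\<in>C. x \<notin> N c"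
proof (rule ccontr)
  assume *: "\<not> ?thesis"
  then have "x \<notin> C" using N_irrefl by blast
  moreover have "indep {x} E" by (simp add: indep_iff N_irrefl)
  ultimately show False using not_dominated[OF assms, of "{x}"] * by simp
qed

lemma strong_nonempty: "strong C \<Longrightarrow> C \<noteq> {}"
  using strong_maximal by blast

lemma strong_adj: "strong C \<Longrightarrow> u \<in> C \<Longrightarrow> v \<in> C \<Longrightarrow> u \<noteq> v \<Longrightarrow> u \<in> N v"
  by (simp add: strong_iff clique_iff)

lemma strong_subset_V: "strong C \<Longrightarrow> C \<subseteq> V"
  by (simp add: strong_iff)

lemma strong_finite: "strong C \<Longrightarrow> finite C"
  using strong_subset_V finite_V finite_subset by blast

lemma strong_diff_subset: "strong C \<Longrightarrow> x \<in> C \<Longrightarrow> C - {x} \<subseteq> N x"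
  using strong_adj by auto

lemma card_strong: "strong C \<Longrightarrow> card C \<le> 4"
proof -
  assume C: "strong C"
  then obtain x where x: "x \<in> C" using strong_nonempty by blast
  have "card (C - {x}) \<le> 3"
    using card_mono[OF finite_N strong_diff_subset[OF C x]] card_N le_trans by blast
  with x strong_finite[OF C] show ?thesis by (simp add: card_Diff_singleton)
qed

lemma strong_not_psubset: "strong C \<Longrightarrow> strong D \<Longrightarrow> C \<subseteq> D \<Longrightarrow> C = D"
proof (rule ccontr)
  assume C: "strong C" and D: "strong D" "C \<subseteq> D" "C \<noteq> D"
  then obtain x where x: "x \<in> D" "x \<notin> C" by blast
  with strong_maximal[OF C, of x] strong_adj[OF D(1)] D(2) show False by (metis subsetD)
qed

text \<open>If a neighbour \<open>z\<close> of \<open>v\<close> is not adjacent to \<open>w\<close>,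
  then \<open>{z, w}\<close> is independent, \<open>z\<close> dominates \<open>v\<close> and
  \<open>w\<close> dominates \<open>K\<close>, against the strength of \<open>insert v K\<close>.
  Used in both directions this gives equal neighbourhoods.\<close>

lemma strong_twins:
  assumes v: "strong (insert v K)" and w: "strong (insert w K)"
    and K: "v \<notin> K" "w \<notin> K" "v \<noteq> w"
  shows "N v \<subseteq> N w"
proof
  fix z assume z: "z \<in> N v"
  show "z \<in> N w"
  proof (rule ccontr)
    assume zw: "z \<notin> N w"
    have "z \<notin> K" using strong_adj[OF w, of z w] zw K by blast
    moreover have "z \<noteq> v" using z N_irrefl by auto
    ultimately have "{z, w} \<inter> insert v K = {}" using K by auto
    moreover have "indep {z, w} E"
      using zw nbs_sym[of z E w] by (auto simp: indep_iff N_irrefl)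
    ultimately obtain c where "c \<in> insert v K" "{z, w} \<inter> N c = {}"
      using not_dominated[OF v] by blast
    moreover have "w \<in> N k" if "k \<in> K" for k using strong_adj[OF w, of w k] that K by auto
    ultimately show False using z by auto
  qed
qed

text \<open>An independent set dominating \<open>insert v K\<close> contains a neighbour of
  \<open>w\<close>, hence not \<open>w\<close> itself, so it would dominate
  \<open>insert w K\<close> as well. \<open>K \<noteq> {}\<close> provides a neighbour of
  \<open>v\<close>, which places \<open>v\<close> in \<open>V\<close>.\<close>

lemma twin_strong:
  assumes w: "strong (insert w K)" "w \<notin> K" and tw: "N v = N w" and K: "K \<noteq> {}"
  shows "strong (insert v K)" "v \<notin> K"
proof -
  have Kw: "K \<subseteq> N w" using strong_adj[OF w(1)] w(2) by auto
  then show vK: "v \<notin> K" using tw N_irrefl by auto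
  have "v \<in> V" using Kw K tw N_imp_V by blast
  moreover have "clique (insert v K) E"
    using strong_adj[OF w(1)] Kw tw nbs_sym[of v] by (auto simp: clique_iff)
  moreover have False
    if I: "indep I E" "I \<inter> insert v K = {}" "\<forall>c\<in>insert v K. I \<inter> N c \<noteq> {}" for I
  proof -
    have "w \<notin> I"
    proof
      assume "w \<in> I"
      moreover obtain y where "y \<in> I" "y \<in> N w" using I(3) tw by auto
      ultimately show False using I(1) by (auto simp: indep_iff)
    qed
    then obtain c where "c \<in> insert w K" "I \<inter> N c = {}"
      using not_dominated[OF w(1) I(1)] I(2) by auto
    with I(3) tw show False by auto
  qed
  ultimately show "strong (insert v K)"
    using strong_subset_V[OF w(1)] unfolding strong_iff by blast
qed

text \<open>Without \<open>x\<close>, the two cliques are incomparable subsets of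
  \<open>N x\<close>, which has at most three elements, so each remainder has one or two elements.
  Equal sizes leave exactly one vertex to be swapped, and \<open>strong_twins\<close> applies;
  unequal sizes give an edge and a triangle.\<close>

lemma intersecting_strong_cases [consumes 5, case_names twins edge_triangle triangle_edge]:
  assumes C: "strong C" and D: "strong D" and "C \<noteq> D" and x: "x \<in> C" "x \<in> D"
  obtains
    (twins) v w K where "C = insert v K" "D = insert w K" "v \<notin> K" "w \<notin> K" "v \<noteq> w"
      "K \<noteq> {}" "N v = N w"
  | (edge_triangle) b c d where "C = {x, b}" "D = {x, c, d}" "x \<noteq> b" "b \<notin> D" "c \<noteq> d"
      "x \<noteq> c" "x \<noteq> d"
  | (triangle_edge) b c d where "D = {x, b}" "C = {x, c, d}" "x \<noteq> b" "b \<notin> C" "c \<noteq> d"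
      "x \<noteq> c" "x \<noteq> d"
proof -
  let ?A = "C - {x}" and ?B = "D - {x}"
  have nsub: "\<not> ?A \<subseteq> ?B" "\<not> ?B \<subseteq> ?A"
    using strong_not_psubset[OF C D] strong_not_psubset[OF D C] assms(3) x by blast+
  have AB: "?A \<subseteq> N x" "?B \<subseteq> N x"
    using strong_diff_subset C D x by blast+
  have fin: "finite ?A" "finite ?B" using AB finite_N finite_subset by blast+
  have un: "card (?A \<union> ?B) \<le> 3"
    using card_mono[OF finite_N, of "?A \<union> ?B" x] AB card_N[of x] le_trans by blast
  have "card ?A < card (?A \<union> ?B)" "card ?B < card (?A \<union> ?B)"
    using nsub fin by (auto intro!: psubset_card_mono)
  moreover have "card ?A \<noteq> 0" "card ?B \<noteq> 0" using nsub fin by auto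
  ultimately have "(card ?A = 1 \<or> card ?A = 2) \<and> (card ?B = 1 \<or> card ?B = 2)"
    using un by linarith
  then consider "card ?A = 1" "card ?B = 1" | "card ?A = 1" "card ?B = 2"
    | "card ?A = 2" "card ?B = 1" | "card ?A = 2" "card ?B = 2"
    by blast
  then show ?thesis
  proof cases
    case 1
    obtain b where "?A = {b}" using 1(1) by (rule card_1_singletonE)
    moreover obtain c where "?B = {c}" using 1(2) by (rule card_1_singletonE)
    ultimately have bc: "?A = {b}" "?B = {c}" .
    then have eq: "C = insert b {x}" "D = insert c {x}" "b \<notin> {x}" "c \<notin> {x}" "b \<noteq> c"
      using x nsub by auto
    then have "N b = N c"
      using strong_twins[of b "{x}" c] strong_twins[of c "{x}" b] C D by auto
    with eq show ?thesis by (intro twins[of b "{x}" c]) auto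
  next
    case 2
    obtain b where b: "?A = {b}" using 2(1) by (rule card_1_singletonE)
    obtain c d where "?B = {c, d}" "c \<noteq> d" using 2(2) by (auto simp: card_2_iff)
    with b x nsub show ?thesis by (intro edge_triangle[of b c d]) auto
  next
    case 3
    obtain b where b: "?B = {b}" using 3(2) by (rule card_1_singletonE)
    obtain c d where "?A = {c, d}" "c \<noteq> d" using 3(1) by (auto simp: card_2_iff)
    with b x nsub show ?thesis by (intro triangle_edge[of b c d]) auto
  next
    case 4
    \<comment> \<open>Two pairs inside a set of three elements share some \<open>k\<close>; together
      with \<open>x\<close> it is the common part.\<close>
    have "card (?A \<inter> ?B) \<noteq> 0"
      using card_Un_Int[OF fin] un 4 by linarith
    then obtain k where k: "k \<in> ?A" "k \<in> ?B" by (metis Int_iff card.empty equals0I)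
    obtain v where v: "?A = {k, v}" "v \<noteq> k" using card_2_elem[OF 4(1) k(1)] .
    obtain w where w: "?B = {k, w}" "w \<noteq> k" using card_2_elem[OF 4(2) k(2)] .
    have eq: "C = insert v {x, k}" "D = insert w {x, k}" "v \<notin> {x, k}" "w \<notin> {x, k}" "v \<noteq> w"
      using v w x nsub by auto
    then have "N v = N w"
      using strong_twins[of v "{x, k}" w] strong_twins[of w "{x, k}" v] C D by auto
    with eq show ?thesis by (intro twins[of v "{x, k}" w]) auto
  qed
qed

end

section \<open>Graphs with a fixed partition into strong cliques\<close>

locale partitioned_graph = subcubic_graph +
  fixes P assumes P: "partition_on V P" "\<And>C. C \<in> P \<Longrightarrow> strong C"
begin

lemma part: assumes "v \<in> V" obtains C where "C \<in> P" "v \<in> C" "strong C"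
  using assms P by (auto simp: partition_on_def)

lemma part_disjoint: "C \<in> P \<Longrightarrow> D \<in> P \<Longrightarrow> x \<in> C \<Longrightarrow> x \<in> D \<Longrightarrow> C = D"
  using P(1) by (auto simp: partition_on_def disjoint_def)

text \<open>In the partition \<open>c\<close> is covered by another clique than \<open>{a, c, d}\<close>, as \<open>a\<close> is needed to
  cover the leaf \<open>b\<close>.\<close>

lemma leaf_at_triangle:
  assumes Y: "strong Y" "Y = {a, c, d}" and ne: "a \<noteq> c" "c \<noteq> d" "a \<noteq> d"
    and a: "N a = {b, c, d}" and b: "N b = {a}" and bY: "b \<notin> Y"
  obtains c' where "c' \<notin> Y" "N c' = {c}"
proof -
  have V: "b \<in> V" "c \<in> V" using N_subset a by auto
  obtain Q where Q: "Q \<in> P" "b \<in> Q" "strong Q" using part[OF V(1)] .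
  \<comment> \<open>The partition clique of the leaf \<open>b\<close> is the edge
    \<open>{a, b}\<close>: alone, \<open>b\<close> would be dominated by \<open>a\<close>.\<close>
  have "Q \<subseteq> {a, b}" using strong_diff_subset[OF Q(3,2)] b by auto
  moreover have "Q \<noteq> {b}" using strong_maximal[OF Q(3), of a] a b nbs_sym[of a E b] by auto
  ultimately have Qab: "a \<in> Q" using Q(2) by blast
  obtain Q' where Q': "Q' \<in> P" "c \<in> Q'" "strong Q'" using part[OF V(2)] .
  have "c \<notin> Q" using \<open>Q \<subseteq> {a, b}\<close> ne bY Y by auto
  then have aQ': "a \<notin> Q'" using part_disjoint Q Q' Qab by blast
  then have "Y \<noteq> Q'" using Y by auto
  have aY: "a \<in> Y" and cY: "c \<in> Y" and dY: "d \<in> Y" using Y by simp_all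
  from Y(1) Q'(3) \<open>Y \<noteq> Q'\<close> cY Q'(2) show ?thesis
  proof (cases rule: intersecting_strong_cases)
    \<comment> \<open>The swap would exchange \<open>a\<close> for a twin of \<open>a\<close>, which
      would be a second neighbour of the leaf \<open>b\<close>.\<close>
    case (twins v w K)
    have "a \<in> insert v K" using aY unfolding twins(1) .
    moreover have "a \<notin> K" using aQ' unfolding twins(2) by simp
    ultimately have "v = a" by simp
    moreover have "b \<in> N a" using a by simp
    ultimately have "b \<in> N w" using twins(7) by simp
    then have "w \<in> N b" using nbs_sym[of b E w] by simp
    then show ?thesis using b twins(5) \<open>v = a\<close> by simp
  next
    case (edge_triangle e f g)
    have "a = e" "d = e" using aY dY ne unfolding edge_triangle(1) by simp_all
    then show ?thesis using ne by simp
  next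
    case (triangle_edge c' f g)
    have c': "c' \<in> N c" "c' \<noteq> a" "c' \<noteq> c" "c' \<noteq> d"
      using strong_adj[OF Q'(3), of c' c] triangle_edge(1,3,4) aY dY by auto
    have Q'c: "Q' = {c, c'}" by (rule triangle_edge(1))
    \<comment> \<open>A neighbour \<open>z \<noteq> c\<close> of \<open>c'\<close> must be equal or
      adjacent to each of \<open>a\<close> and \<open>d\<close>; otherwise \<open>{z, a}\<close> or
      \<open>{z, d}\<close> would dominate the clique \<open>{c, c'}\<close>. The candidates
      \<open>b\<close> and \<open>d\<close> left by \<open>N a\<close> fail: \<open>b\<close> is a
      leaf at \<open>a\<close>, and \<open>d\<close> would be adjacent to both \<open>c\<close> and
      \<open>c'\<close>.\<close>
    have "z = c" if z: "z \<in> N c'" for z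
    proof (rule ccontr)
      assume zc: "z \<noteq> c"
      have dom: "z \<in> N t \<or> z = t" if t: "t \<in> {a, d}" for t
      proof (rule ccontr)
        assume "\<not> ?thesis"
        then have "indep {z, t} E" using nbs_sym[of z E t] by (auto simp: indep_iff N_irrefl)
        moreover have "{z, t} \<inter> Q' = {}"
          using z zc t c' ne N_irrefl[of c'] unfolding Q'c by auto
        moreover have "t \<in> N c"
          using strong_adj[OF Y(1), of t c] aY dY cY t ne by auto
        ultimately show False
          using not_dominated[OF Q'(3), of "{z, t}"] z unfolding Q'c by auto
      qed
      have "z \<noteq> a"
      proof
        assume "z = a"
        then have "c' \<in> N a" using z nbs_sym[of a E c'] by simp
        then have "c' = b" using a c' by simp
        then show False using c'(1) b nbs_sym[of b E c] ne by simp
      qed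
      then have "z \<in> N a" using dom by blast
      with a zc have "z = b \<or> z = d" by auto
      moreover have "z \<noteq> b" using z b nbs_sym[of b E c'] c' by auto
      moreover have "z \<noteq> d"
      proof
        assume "z = d"
        moreover have "d \<in> N c" using strong_adj[OF Y(1) dY cY] ne by simp
        ultimately show False using strong_maximal[OF Q'(3), of d] z unfolding Q'c by simp
      qed
      ultimately show False by blast
    qed
    moreover have "c \<in> N c'" using c' nbs_sym[of c E c'] by simp
    ultimately have "N c' = {c}" by blast
    with triangle_edge(4) that show ?thesis by blast
  qed
qed

text \<open>The five vertices form the complete graph on \<open>a\<close>, \<open>c\<close>,
  \<open>d\<close>, \<open>z\<close> with the edge between \<open>a\<close> and \<open>z\<close>
  subdivided by \<open>b\<close>. If \<open>b\<close> were a leaf, then \<open>c\<close> and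
  \<open>d\<close> would carry leaves too, and the three leaves would dominate the triangle. Any
  further neighbour of \<open>b\<close> is forced to be adjacent to \<open>c\<close> and
  \<open>d\<close>, and the degree bound then fixes all neighbourhoods. So \<open>a\<close> and
  \<open>z\<close> are twins, which transfers strength to the cliques at \<open>z\<close>.\<close>

lemma house:
  assumes X: "strong {a, b}" and Y: "strong {a, c, d}"
    and ne: "a \<noteq> b" "b \<noteq> c" "b \<noteq> d" "a \<noteq> c" "c \<noteq> d" "a \<noteq> d"
  obtains z where "z \<notin> {a, b, c, d}" "N a = {b, c, d}" "N b = {a, z}" "N c = {a, d, z}"
    "N d = {a, c, z}" "N z = {b, c, d}" "strong {z, b}" "strong {z, c, d}"
proof -
  have adj: "b \<in> N a" "c \<in> N a" "d \<in> N a" "a \<in> N b" "a \<in> N c" "d \<in> N c" "a \<in> N d" "c \<in> N d"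
    using strong_adj[OF X] strong_adj[OF Y] ne by auto
  have Na: "N a = {b, c, d}" using adj ne by (intro N_eq) auto
  have "N b \<noteq> {a}"
  proof
    assume Nb: "N b = {a}"
    obtain c' where c': "c' \<notin> {a, c, d}" "N c' = {c}"
      using leaf_at_triangle[OF Y refl] ne Na Nb by auto
    have "{a, c, d} = {a, d, c}" "{b, c, d} = {b, d, c}" by auto
    then obtain d' where d': "d' \<notin> {a, c, d}" "N d' = {d}"
      using leaf_at_triangle[of "{a, c, d}" a d c b] Y ne Na Nb by auto
    have "indep {b, c', d'} E" using c' d' Nb ne by (auto simp: indep_iff)
    moreover have "{b, c', d'} \<inter> {a, c, d} = {}" using c' d' ne by auto
    moreover have "c' \<in> N c" "d' \<in> N d"
      using c' d' nbs_sym[of c E c'] nbs_sym[of d E d'] by auto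
    ultimately show False using not_dominated[OF Y] adj by auto
  qed
  with adj obtain z where z: "z \<in> N b" "z \<noteq> a" by blast
  \<comment> \<open>If \<open>y\<close> missed \<open>t\<close>, the pair would be independent, with
    \<open>y\<close> dominating \<open>b\<close> and \<open>t\<close> dominating
    \<open>a\<close>.\<close>
  have nbr: "y \<in> N t \<and> y \<noteq> t" if y: "y \<in> N b" "y \<noteq> a" and t: "t \<in> {c, d}" for y t
  proof
    have ta: "t \<in> N a" using t adj by auto
    show "y \<noteq> t" using strong_maximal[OF X, of t] ta y by auto
    show "y \<in> N t"
    proof (rule ccontr)
      assume "y \<notin> N t"
      then have "indep {y, t} E" using nbs_sym[of y E t] by (auto simp: indep_iff N_irrefl)
      moreover have "{y, t} \<inter> {a, b} = {}" using y t ne N_irrefl by auto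
      ultimately show False using not_dominated[OF X, of "{y, t}"] y ta by auto
    qed
  qed
  have zc: "z \<in> N c" "z \<in> N d" "z \<noteq> c" "z \<noteq> d" using nbr[OF z] by auto
  have zb: "z \<noteq> b" using z N_irrefl by auto
  have Nc: "N c = {a, d, z}" using adj zc z ne by (intro N_eq) auto
  have Nd: "N d = {a, c, z}" using adj zc z ne by (intro N_eq) auto
  have Nz: "N z = {b, c, d}"
    using z zc ne nbs_sym[of z E] by (intro N_eq) auto
  \<comment> \<open>\<open>y\<close> is a neighbour of \<open>c\<close> different from
    \<open>a\<close> and \<open>d\<close>, so only \<open>z\<close> is left in
    \<open>N c\<close>.\<close>
  have "y = z" if "y \<in> N b" "y \<noteq> a" for y
    using nbr[OF that, of c] nbr[OF that, of d] that(2) Nc by simp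
  then have Nb: "N b = {a, z}" using adj(4) z(1) by blast
  have tw: "N z = N a" using Na Nz by simp
  show ?thesis
  proof (rule that[of z])
    show "z \<notin> {a, b, c, d}" using z(2) zc zb by simp
    show "strong {z, b}" using twin_strong(1)[of a "{b}" z] X tw ne by simp
    show "strong {z, c, d}" using twin_strong(1)[of a "{c, d}" z] Y tw ne by simp
  qed (fact Na Nb Nc Nd Nz)+
qed

text \<open>Any greedily chosen disjoint strong cliques can be extended: two intersecting strong cliques
  are related by a swap of twins or lie in a component with five vertices, and four twins with a
  common neighbour would exceed the degree bound.\<close>

lemma extend_disjoint_strong:
  assumes F: "\<And>C. C \<in> F \<Longrightarrow> strong C" "\<And>C D. C \<in> F \<Longrightarrow> D \<in> F \<Longrightarrow> C \<noteq> D \<Longrightarrow> C \<inter> D = {}"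
    and v: "v \<in> V" "\<And>C. C \<in> F \<Longrightarrow> v \<notin> C"
  shows "\<exists>D. strong D \<and> v \<in> D \<and> (\<forall>C\<in>F. C \<inter> D = {})"
proof (rule ccontr)
  assume "\<not> ?thesis"
  then have hit: "\<exists>C\<in>F. C \<inter> D \<noteq> {}" if "strong D" "v \<in> D" for D
    using that by blast
  \<comment> \<open>Every block is a swap of \<open>v\<close> for a twin: the other two cases end in
    the five-vertex component, where a second strong clique around \<open>v\<close> could only be
    blocked by a member all of whose vertices are adjacent to \<open>v\<close>.\<close>
  have twin: "\<exists>w K. D = insert v K \<and> C = insert w K \<and> v \<notin> K \<and> w \<notin> K \<and> v \<noteq> w \<and> N v = N w"
    if D: "strong D" "v \<in> D" and C: "C \<in> F" "C \<inter> D \<noteq> {}" for C D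
  proof -
    obtain x where x: "x \<in> C" "x \<in> D" using C(2) by blast
    have vC: "v \<notin> C" using v(2) C(1) .
    then have "C \<noteq> D" using D(2) by auto
    from F(1)[OF C(1)] D(1) \<open>C \<noteq> D\<close> x show ?thesis
    proof (cases rule: intersecting_strong_cases)
      case (twins w u K)
      have "v \<in> insert u K" using D(2) unfolding twins(2) .
      moreover have "v \<notin> K" using vC unfolding twins(1) by simp
      ultimately have "u = v" by simp
      show ?thesis
      proof (intro exI conjI)
        show "D = insert v K" "C = insert w K" using twins(1,2) \<open>u = v\<close> by simp_all
        show "v \<notin> K" "w \<notin> K" "v \<noteq> w" "N v = N w" using twins(3,4,5,7) \<open>u = v\<close> by auto
      qed
    next
      case (edge_triangle b c d)
      have X: "strong {x, b}" using F(1)[OF C(1)] unfolding edge_triangle(1) .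
      have Y: "strong {x, c, d}" using D(1) unfolding edge_triangle(2) .
      have ne: "x \<noteq> b" "b \<noteq> c" "b \<noteq> d" "x \<noteq> c" "c \<noteq> d" "x \<noteq> d"
        using edge_triangle(3-7) unfolding edge_triangle(2) by auto
      obtain z where z: "z \<notin> {x, b, c, d}" "N x = {b, c, d}" "N b = {x, z}" "N c = {x, d, z}"
        "N d = {x, c, z}" "N z = {b, c, d}" "strong {z, b}" "strong {z, c, d}"
        by (rule house[OF X Y ne])
      have v': "v \<in> {c, d}" using vC D(2) unfolding edge_triangle(1,2) by simp
      then obtain C' where C': "C' \<in> F" "C' \<inter> {z, c, d} \<noteq> {}"
        using hit[OF z(8)] by blast
      have "x \<in> C" "b \<in> C" unfolding edge_triangle(1) by simp_all
      have "C \<inter> {z, c, d} = {}" unfolding edge_triangle(1) using z(1) ne by simp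
      then have "C' \<noteq> C" using C'(2) by blast
      then have "C' \<inter> C = {}" using F(2) C' C by blast
      then have xb: "x \<notin> C'" "b \<notin> C'" using \<open>x \<in> C\<close> \<open>b \<in> C\<close> by blast+
      obtain t where t: "t \<in> C'" "t \<in> {z, c, d}" using C'(2) by blast
      \<comment> \<open>The vertex \<open>t\<close> of \<open>C'\<close> has all its neighbours
        among the five vertices, and \<open>x\<close> and \<open>b\<close> are taken by
        \<open>C\<close>. So \<open>C'\<close> stays inside a triangle that contains
        \<open>v\<close>.\<close>
      have sub: "y \<in> {z, c, d}" if y: "y \<in> C'" for y
      proof -
        have "y = t \<or> y \<in> N t" using strong_adj[OF F(1)[OF C'(1)] y t(1)] by blast
        moreover have "N t \<subseteq> {x, b, c, d, z}" using t(2) z(4-6) by blast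
        moreover have "y \<noteq> x" "y \<noteq> b" using y xb by blast+
        ultimately show ?thesis using t(2) by blast
      qed
      have "v \<in> N y" if y: "y \<in> C'" for y
      proof -
        have "v \<noteq> y" using y v(2)[OF C'(1)] by blast
        then show ?thesis using strong_adj[OF z(8) _ sub[OF y]] v' by blast
      qed
      then show ?thesis using strong_maximal[OF F(1)[OF C'(1)], of v] by blast
    next
      case (triangle_edge b c d)
      have X: "strong {x, b}" using D(1) unfolding triangle_edge(1) .
      have Y: "strong {x, c, d}" using F(1)[OF C(1)] unfolding triangle_edge(2) .
      have ne: "x \<noteq> b" "b \<noteq> c" "b \<noteq> d" "x \<noteq> c" "c \<noteq> d" "x \<noteq> d"
        using triangle_edge(3-7) unfolding triangle_edge(2) by auto
      obtain z where z: "z \<notin> {x, b, c, d}" "N x = {b, c, d}" "N b = {x, z}" "N c = {x, d, z}"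
        "N d = {x, c, z}" "N z = {b, c, d}" "strong {z, b}" "strong {z, c, d}"
        by (rule house[OF X Y ne])
      have vb: "v = b" using vC D(2) unfolding triangle_edge(1,2) by simp
      then obtain C' where C': "C' \<in> F" "C' \<inter> {z, b} \<noteq> {}" using hit[OF z(7)] by blast
      have bC': "b \<notin> C'" using v(2)[OF C'(1)] vb by simp
      then have zC': "z \<in> C'" using C'(2) by blast
      have cdC: "c \<in> C" "d \<in> C" unfolding triangle_edge(2) by simp_all
      have "z \<notin> C" unfolding triangle_edge(2) using z(1) by simp
      then have "C' \<noteq> C" using zC' by blast
      then have "C' \<inter> C = {}" using F(2) C' C by blast
      then have "c \<notin> C'" "d \<notin> C'" using cdC by blast+
      \<comment> \<open>The neighbours of \<open>z\<close> are \<open>b\<close>, which is uncovered,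
        and \<open>c\<close>, \<open>d\<close>, which belong to \<open>C\<close>. So
        \<open>C'\<close> is just \<open>{z}\<close>, dominated by \<open>b\<close>.\<close>
      moreover have "C' - {z} \<subseteq> {b, c, d}"
        using strong_diff_subset[OF F(1)[OF C'(1)] zC'] unfolding z(6) .
      ultimately have "C' \<subseteq> {z}" using bC' by blast
      then have "\<forall>y\<in>C'. b \<in> N y" using z(6) by blast
      then show ?thesis using strong_maximal[OF F(1)[OF C'(1)], of b] by blast
    qed
  qed
  \<comment> \<open>One round: the partition clique of a twin \<open>w\<close> of \<open>v\<close>
    becomes a strong clique around \<open>v\<close> when \<open>w\<close> is exchanged for
    \<open>v\<close>; the member of \<open>F\<close> that blocks it consists of the same rest
    \<open>K\<close> and a twin \<open>w'\<close>.\<close>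
  have next_clique: "\<exists>D K w'. D \<in> P \<and> D = insert w K \<and> w \<notin> K \<and> K \<noteq> {} \<and> K \<subseteq> N v \<and>
      insert w' K \<in> F \<and> w' \<notin> K \<and> w' \<noteq> v \<and> N w' = N v"
    if w: "N w = N v" "N v \<noteq> {}" for w
  proof -
    have "w \<in> V" using w N_imp_V by blast
    then obtain D where D: "D \<in> P" "w \<in> D" "strong D" using part by blast
    define K where "K = D - {w}"
    have DK: "D = insert w K" "w \<notin> K" using D(2) by (auto simp: K_def)
    obtain k where k: "k \<in> N w" using w by blast
    have "K \<noteq> {}"
    proof
      assume "K = {}"
      then have "\<forall>y\<in>D. k \<in> N y" using DK k by simp
      with strong_maximal[OF D(3), of k] show False by blast
    qed
    have s: "strong (insert v K)" "v \<notin> K"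
      using twin_strong[of w K v] D(3) DK w(1) \<open>K \<noteq> {}\<close> by simp_all
    obtain C where C: "C \<in> F" "C \<inter> insert v K \<noteq> {}" using hit[OF s(1)] by blast
    obtain w' K' where K': "insert v K = insert v K'" "C = insert w' K'" "v \<notin> K'" "w' \<notin> K'"
      "v \<noteq> w'" "N v = N w'"
      using twin[OF s(1) insertI1 C] by blast
    have "K' = K" using K'(1,3) s(2) by (simp add: insert_ident)
    have "K \<subseteq> N v" using strong_diff_subset[OF s(1) insertI1] s(2) by simp
    show ?thesis
    proof (intro exI conjI)
      show "D \<in> P" "D = insert w K" "w \<notin> K" "K \<noteq> {}" "K \<subseteq> N v" by fact+
      show "insert w' K \<in> F" using C(1) K'(2) \<open>K' = K\<close> by simp
      show "w' \<notin> K" "w' \<noteq> v" "N w' = N v" using K'(4-6) \<open>K' = K\<close> by simp_all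
    qed
  qed
  have Nv: "N v \<noteq> {}"
  proof
    assume "N v = {}"
    obtain D where D: "strong D" "v \<in> D" using part[OF v(1)] by blast
    then have "D = {v}" using strong_diff_subset[OF D] \<open>N v = {}\<close> by auto
    then obtain C where "C \<in> F" "v \<in> C" using hit[OF D] by auto
    then show False using v(2) by blast
  qed
  \<comment> \<open>Three rounds, starting from \<open>v\<close> itself. The partition cliques met
    are distinct, hence disjoint, so the rests \<open>K0\<close>, \<open>K1\<close>,
    \<open>K2\<close> are disjoint. The blocking members are therefore distinct members of
    \<open>F\<close>, hence disjoint, and \<open>w0\<close>, \<open>w1\<close>, \<open>w2\<close>
    differ.\<close>
  obtain D0 K0 w0 where 0: "D0 \<in> P" "D0 = insert v K0" "v \<notin> K0" "K0 \<noteq> {}" "K0 \<subseteq> N v"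
    "insert w0 K0 \<in> F" "w0 \<notin> K0" "w0 \<noteq> v" "N w0 = N v"
    using next_clique[OF refl Nv] by blast
  obtain D1 K1 w1 where 1: "D1 \<in> P" "D1 = insert w0 K1" "w0 \<notin> K1" "K1 \<noteq> {}" "K1 \<subseteq> N v"
    "insert w1 K1 \<in> F" "w1 \<notin> K1" "w1 \<noteq> v" "N w1 = N v"
    using next_clique[OF 0(9) Nv] by blast
  have "w0 \<notin> D0" "w0 \<in> D1" using 0(2,7,8) 1(2) by simp_all
  then have D01: "D0 \<inter> D1 = {}" using part_disjoint 0(1) 1(1) by blast
  have "K1 \<inter> insert w0 K0 = {}" using D01 1(3) unfolding 0(2) 1(2) by blast
  then have "insert w0 K0 \<noteq> insert w1 K1" using 1(4) by blast
  then have F01: "insert w0 K0 \<inter> insert w1 K1 = {}" using F(2)[OF 0(6) 1(6)] by blast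
  obtain D2 K2 w2 where 2: "D2 \<in> P" "D2 = insert w1 K2" "w1 \<notin> K2" "K2 \<noteq> {}" "K2 \<subseteq> N v"
    "insert w2 K2 \<in> F" "w2 \<notin> K2" "w2 \<noteq> v" "N w2 = N v"
    using next_clique[OF 1(9) Nv] by blast
  have "w1 \<notin> D0" "w1 \<notin> D1" "w1 \<in> D2"
    using F01 0(2,8) 1(2,7,8) 2(2) by auto
  then have D02: "D0 \<inter> D2 = {}" and D12: "D1 \<inter> D2 = {}"
    using part_disjoint 0(1) 1(1) 2(1) by blast+
  have "K2 \<inter> insert w0 K0 = {}" "K2 \<inter> insert w1 K1 = {}"
    using D02 D12 2(3) unfolding 0(2) 1(2) 2(2) by blast+
  then have "insert w0 K0 \<noteq> insert w2 K2" "insert w1 K1 \<noteq> insert w2 K2"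
    using 2(4) by blast+
  then have "insert w0 K0 \<inter> insert w2 K2 = {}" "insert w1 K1 \<inter> insert w2 K2 = {}"
    using F(2)[OF 0(6) 2(6)] F(2)[OF 1(6) 2(6)] by blast+
  with F01 have ne: "w0 \<noteq> w1" "w0 \<noteq> w2" "w1 \<noteq> w2" by blast+
  obtain k where "k \<in> N v" using Nv by blast
  then have "w \<in> N k" if "N w = N v" for w using that nbs_sym[of k E w] by simp
  then have "{v, w0, w1, w2} \<subseteq> N k" using 0(9) 1(9) 2(9) by simp
  then have "card {v, w0, w1, w2} \<le> card (N k)" by (intro card_mono finite_N)
  moreover have "card {v, w0, w1, w2} = 4" using ne 0(8) 1(8) 2(8) by auto
  ultimately show False using card_N[of k] by simp
qed

end

section \<open>A local criterion for localizability\<close>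

context subcubic_graph
begin

theorem localizable_iff:
  "localizable V E \<longleftrightarrow> (\<forall>v\<in>V. \<forall>c :: nat \<Rightarrow> 'a set.
     (\<forall>i<3. c i \<subseteq> V \<and> c i \<noteq> {} \<and> card (c i) \<le> 4) \<longrightarrow>
     (\<forall>i<3. v \<in> c i \<or> strong (c i)) \<longrightarrow>
     (\<forall>i<3. \<forall>j<3. v \<in> c i \<or> v \<in> c j \<or> c i = c j \<or> c i \<inter> c j = {}) \<longrightarrow>
     (\<exists>D. strong D \<and> v \<in> D \<and> (\<forall>i<3. v \<in> c i \<or> c i \<inter> D = {})))"
    (is "_ \<longleftrightarrow> ?R")
proof
  assume "localizable V E"
  then obtain P where "partition_on V P" "\<forall>C\<in>P. strong C" by (auto simp: localizable_def)
  then interpret partitioned_graph V E P by unfold_locales auto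
  show ?R
  proof (intro ballI allI impI)
    fix v and c :: "nat \<Rightarrow> 'a set"
    assume v: "v \<in> V" and c: "\<forall>i<3. v \<in> c i \<or> strong (c i)"
      "\<forall>i<3. \<forall>j<3. v \<in> c i \<or> v \<in> c j \<or> c i = c j \<or> c i \<inter> c j = {}"
    let ?F = "{c i |i. i < 3 \<and> v \<notin> c i}"
    have F: "strong C" "v \<notin> C" if "C \<in> ?F" for C using that c(1) by auto
    have disj: "C \<inter> C' = {}" if "C \<in> ?F" "C' \<in> ?F" "C \<noteq> C'" for C C'
      using that c(2) by blast
    have "\<exists>D. strong D \<and> v \<in> D \<and> (\<forall>C\<in>?F. C \<inter> D = {})"
      by (rule extend_disjoint_strong[OF F(1) disj v F(2)])
    then show "\<exists>D. strong D \<and> v \<in> D \<and> (\<forall>i<3. v \<in> c i \<or> c i \<inter> D = {})" by blast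
  qed
next
  assume R: ?R
  define \<F> where
    "\<F> = {F. (\<forall>C\<in>F. strong C) \<and> (\<forall>C\<in>F. \<forall>D\<in>F. C \<noteq> D \<longrightarrow> C \<inter> D = {})}"
  have "\<F> \<subseteq> Pow (Pow V)"
  proof
    fix F assume "F \<in> \<F>"
    then have "\<forall>C\<in>F. strong C" by (simp add: \<F>_def)
    then show "F \<in> Pow (Pow V)" using strong_subset_V by blast
  qed
  moreover have "finite (Pow (Pow V))" using finite_V by simp
  ultimately have "finite \<F>" by (rule finite_subset)
  moreover have "\<F> \<noteq> {}" by (auto simp: \<F>_def)
  ultimately have "\<exists>F\<in>\<F>. \<forall>G\<in>\<F>. F \<subseteq> G \<longrightarrow> F = G" by (rule finite_has_maximal)
  then obtain F where "F \<in> \<F>" and max: "\<forall>G\<in>\<F>. F \<subseteq> G \<longrightarrow> F = G" ..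
  then have F: "\<And>C. C \<in> F \<Longrightarrow> strong C"
    "\<And>C D. C \<in> F \<Longrightarrow> D \<in> F \<Longrightarrow> C \<noteq> D \<Longrightarrow> C \<inter> D = {}"
    by (simp_all add: \<F>_def)
  have "V \<subseteq> \<Union>F"
  proof
    fix v assume v: "v \<in> V"
    show "v \<in> \<Union>F"
    proof (rule ccontr)
      assume "v \<notin> \<Union>F"
      then have vF: "v \<notin> C" if "C \<in> F" for C using that by blast
      define \<G> where "\<G> = {C \<in> F. C \<inter> N v \<noteq> {}}"
      have GF: "C \<in> F" "C \<inter> N v \<noteq> {}" if "C \<in> \<G>" for C using that by (simp_all add: \<G>_def)
      have "\<forall>C\<in>\<G>. \<exists>y. y \<in> C \<inter> N v" using GF(2) by blast
      from bchoice[OF this] obtain f where f: "\<forall>C\<in>\<G>. f C \<in> C \<inter> N v" ..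
      then have fG: "f C \<in> C" "f C \<in> N v" if "C \<in> \<G>" for C using that by simp_all
      have "inj_on f \<G>"
      proof (rule inj_onI)
        fix C D assume CD: "C \<in> \<G>" "D \<in> \<G>" "f C = f D"
        have "f C \<in> C" "f C \<in> D" using fG(1)[OF CD(1)] fG(1)[OF CD(2)] CD(3) by simp_all
        then show "C = D" using F(2)[OF GF(1)[OF CD(1)] GF(1)[OF CD(2)]] by blast
      qed
      moreover have "f ` \<G> \<subseteq> N v" using fG(2) by blast
      ultimately have G: "finite \<G>" "card \<G> \<le> card (N v)"
        using finite_N by (rule inj_on_finite, rule card_inj_on_le)
      obtain h where h: "bij_betw h {0..<card \<G>} \<G>"
        using ex_bij_betw_nat_finite[OF G(1)] by blast
      define c where "c i = (if i < card \<G> then h i else {v})" for i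
      have c: "c i \<in> \<G> \<or> c i = {v}" for i
        using bij_betwE[OF h] by (simp add: c_def)
      have Gc: "\<exists>i<3. c i = C" if "C \<in> \<G>" for C
      proof -
        have "C \<in> h ` {0..<card \<G>}" using that bij_betw_imp_surj_on[OF h] by simp
        then obtain i where "i < card \<G>" "h i = C" by auto
        moreover from this(1) have "i < 3" using G(2) card_N[of v] by linarith
        ultimately show ?thesis unfolding c_def by (intro exI[of _ i]) simp
      qed
      have cF: "strong (c i) \<or> c i = {v}" for i using c[of i] GF(1) F(1) by blast
      have "c i \<subseteq> V \<and> c i \<noteq> {} \<and> card (c i) \<le> 4" for i
        using cF[of i]
      proof
        assume "strong (c i)"
        then show ?thesis using strong_subset_V strong_nonempty card_strong by blast
      qed (use v in simp)
      moreover have "v \<in> c i \<or> strong (c i)" for i using cF[of i] by blast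
      moreover have "v \<in> c i \<or> v \<in> c j \<or> c i = c j \<or> c i \<inter> c j = {}" for i j
        using c[of i] c[of j] GF(1) F(2)[of "c i" "c j"] by blast
      ultimately obtain D where D: "strong D" "v \<in> D" "\<forall>i<3. v \<in> c i \<or> c i \<inter> D = {}"
        using R[THEN bspec, OF v, THEN spec, of c] by blast
      \<comment> \<open>Apart from \<open>v\<close>, the clique \<open>D\<close> lies in
        \<open>N v\<close>, so a member of \<open>F\<close> that meets \<open>D\<close> also meets
        \<open>N v\<close> and is listed by \<open>c\<close>.\<close>
      have disj: "C \<inter> D = {}" if C: "C \<in> F" for C
      proof (rule ccontr)
        assume "C \<inter> D \<noteq> {}"
        then obtain y where y: "y \<in> C" "y \<in> D" by blast
        then have "y \<in> N v" using strong_adj[OF D(1) y(2) D(2)] vF[OF C] by blast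
        then have "C \<in> \<G>" using C y unfolding \<G>_def by blast
        then obtain i where "i < 3" "c i = C" using Gc by blast
        with D(3) vF[OF C] y show False by blast
      qed
      have "insert D F \<in> \<F>"
        unfolding \<F>_def
      proof (intro CollectI conjI ballI impI)
        fix C assume "C \<in> insert D F"
        then show "strong C" using D(1) F(1) by blast
        fix C' assume "C' \<in> insert D F" "C \<noteq> C'"
        then show "C \<inter> C' = {}" using \<open>C \<in> insert D F\<close> F(2)[of C C'] disj by blast
      qed
      then have "D \<in> F" using max by blast
      with vF D(2) show False by blast
    qed
  qed
  moreover have "\<Union>F \<subseteq> V" using F(1) strong_subset_V by blast
  moreover have "{} \<notin> F" using F(1) strong_nonempty by blast
  moreover have "disjoint F" by (rule disjointI) (rule F(2))
  ultimately have "partition_on V F" unfolding partition_on_def by blast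
  with F(1) show "localizable V E" unfolding localizable_def by blast
qed

end

section \<open>Structured programs for Turing machines\<close>

text \<open>Symbols and actions are indexed by all natural numbers, so programs can be composed
  without fixing a number of tapes; the restriction to finitely many comes only with
  \<open>machine\<close>.\<close>

type_synonym row = "(nat \<Rightarrow> nat) \<Rightarrow> nat \<times> (nat \<Rightarrow> nat \<times> direction)"

text \<open>\<open>Act\<close> treats every tape by its own symbol alone; only the tests of
  \<open>If\<close> and \<open>While\<close> look at several tapes, so only they need a condition on
  the tapes they read.\<close>

datatype com =
    Act "nat \<Rightarrow> nat \<Rightarrow> nat \<times> direction"
  | Seq com com (infixr ";;" 60)
  | If "(nat \<Rightarrow> nat) \<Rightarrow> bool" com com
  | While "(nat \<Rightarrow> nat) \<Rightarrow> bool" com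

fun len :: "com \<Rightarrow> nat" where
  "len (Act g) = 1"
| "len (Seq c d) = len c + len d"
| "len (If b c d) = len c + len d + 2"
| "len (While b c) = len c + 2"

definition jump :: "((nat \<Rightarrow> nat) \<Rightarrow> nat) \<Rightarrow> row" where
  "jump h = (\<lambda>r. (h r, \<lambda>i. (r i, Stay)))"

text \<open>\<open>a\<close> is the state of the first row. Control leaves the code at
  \<open>a + len c\<close>, the row right behind it, so sequential composition is
  concatenation.\<close>

fun code :: "nat \<Rightarrow> com \<Rightarrow> row list" where
  "code a (Act g) = [\<lambda>r. (a + 1, \<lambda>i. g i (r i))]"
| "code a (Seq c d) = code a c @ code (a + len c) d"
| "code a (If b c d) =
     [jump (\<lambda>r. if b r then a + 1 else a + len c + 2)] @ code (a + 1) c @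
     [jump (\<lambda>_. a + len c + len d + 2)] @ code (a + len c + 2) d"
| "code a (While b c) =
     [jump (\<lambda>r. if b r then a + 1 else a + len c + 2)] @ code (a + 1) c @ [jump (\<lambda>_. a)]"

lemma length_code [simp]: "length (code a c) = len c"
  by (induction c arbitrary: a) auto

section \<open>Execution of code and time-bounded postconditions\<close>

definition row_step :: "row list \<Rightarrow> nat \<times> (nat \<Rightarrow> tape) \<Rightarrow> nat \<times> (nat \<Rightarrow> tape)" where
  "row_step P = (\<lambda>(q, \<sigma>). if q < length P
     then let (q', acts) = (P ! q) (read_tape \<circ> \<sigma>) in (q', \<lambda>i. act_tape (acts i) (\<sigma> i))
     else (q, \<sigma>))"

definition code_at :: "row list \<Rightarrow> nat \<Rightarrow> row list \<Rightarrow> bool" where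
  "code_at P a rs \<longleftrightarrow> (\<exists>xs ys. P = xs @ rs @ ys \<and> length xs = a)"

lemma code_at_append:
  "code_at P a (rs @ rs') \<longleftrightarrow> code_at P a rs \<and> code_at P (a + length rs) rs'"
proof
  assume "code_at P a (rs @ rs')"
  then obtain xs ys where P: "P = xs @ rs @ rs' @ ys" "length xs = a"
    by (auto simp: code_at_def)
  then have "P = (xs @ rs) @ rs' @ ys" by simp
  moreover have "length (xs @ rs) = a + length rs" using P by simp
  ultimately show "code_at P a rs \<and> code_at P (a + length rs) rs'"
    using P unfolding code_at_def by blast
next
  assume "code_at P a rs \<and> code_at P (a + length rs) rs'"
  then obtain xs ys xs' ys' where P: "P = xs @ rs @ ys" "length xs = a"
    "P = xs' @ rs' @ ys'" "length xs' = a + length rs"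
    unfolding code_at_def by blast
  then have "(xs @ rs) @ ys = xs' @ rs' @ ys'" "length (xs @ rs) = length xs'" by simp_all
  then have "xs' = xs @ rs" using append_eq_append_conv by blast
  with P have "P = xs @ (rs @ rs') @ ys'" by simp
  with P(2) show "code_at P a (rs @ rs')" unfolding code_at_def by blast
qed

lemma code_at_nth: "code_at P a [r] \<Longrightarrow> a < length P \<and> P ! a = r"
  by (auto simp: code_at_def)

text \<open>Quantifying over all placements of the code makes this compositional although jump targets
  are absolute.\<close>

definition run :: "com \<Rightarrow> (nat \<Rightarrow> tape) \<Rightarrow> nat \<Rightarrow> ((nat \<Rightarrow> tape) \<Rightarrow> bool) \<Rightarrow> bool" where
  "run c \<sigma> T Q \<longleftrightarrow> (\<forall>P a. code_at P a (code a c) \<longrightarrow>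
     (\<exists>t\<le>T. \<exists>\<sigma>'. (row_step P ^^ t) (a, \<sigma>) = (a + len c, \<sigma>') \<and> Q \<sigma>'))"

lemma runE:
  assumes "run c \<sigma> T Q" "code_at P a (code a c)"
  obtains t \<sigma>' where "t \<le> T" "(row_step P ^^ t) (a, \<sigma>) = (a + len c, \<sigma>')" "Q \<sigma>'"
  using assms unfolding run_def by blast

lemma run_mono:
  assumes "run c \<sigma> T Q" "T \<le> T'" "\<And>\<sigma>'. Q \<sigma>' \<Longrightarrow> Q' \<sigma>'"
  shows "run c \<sigma> T' Q'"
  unfolding run_def
proof (intro allI impI)
  fix P a assume "code_at P a (code a c)"
  from runE[OF assms(1) this] obtain t \<sigma>' where
    "t \<le> T" "(row_step P ^^ t) (a, \<sigma>) = (a + len c, \<sigma>')" "Q \<sigma>'" by blast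
  with assms(2,3) show "\<exists>t\<le>T'. \<exists>\<sigma>'. (row_step P ^^ t) (a, \<sigma>) = (a + len c, \<sigma>') \<and> Q' \<sigma>'"
    by (meson le_trans)
qed

definition act_all :: "(nat \<Rightarrow> nat \<Rightarrow> nat \<times> direction) \<Rightarrow> (nat \<Rightarrow> tape) \<Rightarrow> nat \<Rightarrow> tape" where
  "act_all g \<sigma> = (\<lambda>i. act_tape (g i (read_tape (\<sigma> i))) (\<sigma> i))"

lemma act_tape_read [simp]: "act_tape (read_tape \<tau>, Stay) \<tau> = \<tau>"
  by (cases \<tau>) (simp add: act_tape_def read_tape_def)

lemma row_step_jump:
  "code_at P a [jump h] \<Longrightarrow> row_step P (a, \<sigma>) = (h (read_tape \<circ> \<sigma>), \<sigma>)"
  by (drule code_at_nth) (simp add: row_step_def jump_def)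

lemma run_Act: "Q (act_all g \<sigma>) \<Longrightarrow> run (Act g) \<sigma> 1 Q"
  unfolding run_def
proof (intro allI impI)
  fix P a assume Q: "Q (act_all g \<sigma>)" and "code_at P a (code a (Act g))"
  then have "a < length P \<and> P ! a = (\<lambda>r. (a + 1, \<lambda>i. g i (r i)))"
    by (intro code_at_nth) simp
  then have "(row_step P ^^ 1) (a, \<sigma>) = (a + len (Act g), act_all g \<sigma>)"
    by (simp add: row_step_def act_all_def)
  with Q show "\<exists>t\<le>1. \<exists>\<sigma>'. (row_step P ^^ t) (a, \<sigma>) = (a + len (Act g), \<sigma>') \<and> Q \<sigma>'"
    by blast
qed

lemma funpow_trans:
  "(f ^^ s) x = y \<Longrightarrow> (f ^^ t) y = z \<Longrightarrow> (f ^^ (s + t)) x = z"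
  by (simp only: add.commute[of s t] funpow_add comp_apply)

lemma run_Seq:
  assumes "run c \<sigma> S R" "\<And>\<sigma>'. R \<sigma>' \<Longrightarrow> run d \<sigma>' T Q"
  shows "run (c ;; d) \<sigma> (S + T) Q"
  unfolding run_def
proof (intro allI impI)
  fix P a assume "code_at P a (code a (c ;; d))"
  then have P: "code_at P a (code a c)" "code_at P (a + len c) (code (a + len c) d)"
    by (auto simp: code_at_append)
  then obtain s \<sigma>' where 1: "s \<le> S" "(row_step P ^^ s) (a, \<sigma>) = (a + len c, \<sigma>')" "R \<sigma>'"
    using runE[OF assms(1)] by blast
  obtain t \<sigma>'' where
    "t \<le> T" "(row_step P ^^ t) (a + len c, \<sigma>') = (a + len c + len d, \<sigma>'')" "Q \<sigma>''"
    using runE[OF assms(2)[OF 1(3)] P(2)] by blast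
  moreover have "(row_step P ^^ (s + t)) (a, \<sigma>) = (a + len c + len d, \<sigma>'')"
    by (rule funpow_trans[OF 1(2) calculation(2)])
  ultimately show "\<exists>t\<le>S + T. \<exists>\<sigma>'. (row_step P ^^ t) (a, \<sigma>) = (a + len (c ;; d), \<sigma>') \<and> Q \<sigma>'"
    using 1(1) by (intro exI[of _ "s + t"] conjI exI[of _ \<sigma>'']) (simp_all add: add.assoc)
qed

text \<open>The two extra steps are the test and, after the first branch, the jump over the
  second.\<close>

lemma run_If:
  assumes "b (read_tape \<circ> \<sigma>) \<Longrightarrow> run c \<sigma> T Q" "\<not> b (read_tape \<circ> \<sigma>) \<Longrightarrow> run d \<sigma> T Q"
  shows "run (If b c d) \<sigma> (T + 2) Q"
  unfolding run_def
proof (intro allI impI)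
  fix P a assume "code_at P a (code a (If b c d))"
  then have P: "code_at P a [jump (\<lambda>r. if b r then a + 1 else a + len c + 2)]"
    "code_at P (a + 1) (code (a + 1) c)"
    "code_at P (a + len c + 1) [jump (\<lambda>_. a + len c + len d + 2)]"
    "code_at P (a + len c + 2) (code (a + len c + 2) d)"
    by (simp_all add: code_at_append add.commute del: append_Cons append_Nil append.simps)
  show "\<exists>t\<le>T + 2. \<exists>\<sigma>'. (row_step P ^^ t) (a, \<sigma>) = (a + len (If b c d), \<sigma>') \<and> Q \<sigma>'"
  proof (cases "b (read_tape \<circ> \<sigma>)")
    case True
    obtain t \<sigma>' where
      t: "t \<le> T" "(row_step P ^^ t) (a + 1, \<sigma>) = (a + 1 + len c, \<sigma>')" "Q \<sigma>'"
      using runE[OF assms(1)[OF True] P(2)] by blast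
    have "(row_step P ^^ 1) (a, \<sigma>) = (a + 1, \<sigma>)"
      using row_step_jump[OF P(1), of \<sigma>] True by simp
    moreover have "(row_step P ^^ 1) (a + 1 + len c, \<sigma>') = (a + len (If b c d), \<sigma>')"
      using row_step_jump[OF P(3), of \<sigma>'] by (simp add: add.commute)
    ultimately have "(row_step P ^^ (1 + t + 1)) (a, \<sigma>) = (a + len (If b c d), \<sigma>')"
      using t(2) funpow_trans by metis
    with t show ?thesis by (intro exI[of _ "1 + t + 1"] conjI exI[of _ \<sigma>']) simp_all
  next
    case False
    obtain t \<sigma>' where
      t: "t \<le> T" "(row_step P ^^ t) (a + len c + 2, \<sigma>) = (a + len c + 2 + len d, \<sigma>')" "Q \<sigma>'"
      using runE[OF assms(2)[OF False] P(4)] by blast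
    have "(row_step P ^^ 1) (a, \<sigma>) = (a + len c + 2, \<sigma>)"
      using row_step_jump[OF P(1), of \<sigma>] False by simp
    from funpow_trans[OF this t(2)]
    have "(row_step P ^^ (1 + t)) (a, \<sigma>) = (a + len (If b c d), \<sigma>')"
      by (simp only: len.simps ac_simps)
    with t show ?thesis by (intro exI[of _ "1 + t"] conjI exI[of _ \<sigma>']) simp_all
  qed
qed

text \<open>\<open>I k\<close> is the invariant with at most \<open>k\<close> rounds left. A round
  costs the body, the test and the jump back; the final 1 is the failing test.\<close>

lemma run_While:
  assumes "I k \<sigma>"
    and step: "\<And>k \<sigma>. I k \<sigma> \<Longrightarrow> b (read_tape \<circ> \<sigma>) \<Longrightarrow> \<exists>k'. k = Suc k' \<and> run c \<sigma> T (I k')"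
    and exit: "\<And>k \<sigma>. I k \<sigma> \<Longrightarrow> \<not> b (read_tape \<circ> \<sigma>) \<Longrightarrow> Q \<sigma>"
  shows "run (While b c) \<sigma> (k * (T + 2) + 1) Q"
  unfolding run_def
proof (intro allI impI)
  fix P a assume "code_at P a (code a (While b c))"
  then have P: "code_at P a [jump (\<lambda>r. if b r then a + 1 else a + len c + 2)]"
    "code_at P (a + 1) (code (a + 1) c)" "code_at P (a + len c + 1) [jump (\<lambda>_. a)]"
    by (simp_all add: code_at_append add.commute del: append_Cons append_Nil append.simps)
  show "\<exists>t\<le>k * (T + 2) + 1. \<exists>\<sigma>'.
    (row_step P ^^ t) (a, \<sigma>) = (a + len (While b c), \<sigma>') \<and> Q \<sigma>'"
    using assms(1)
  proof (induction k arbitrary: \<sigma>)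
    case (0 \<sigma>)
    with step have "\<not> b (read_tape \<circ> \<sigma>)" by blast
    with 0 exit row_step_jump[OF P(1), of \<sigma>] show ?case
      by (intro exI[of _ 1] conjI exI[of _ \<sigma>]) simp_all
  next
    case (Suc k \<sigma>)
    show ?case
    proof (cases "b (read_tape \<circ> \<sigma>)")
      case True
      with step Suc.prems have "run c \<sigma> T (I k)" by blast
      from runE[OF this P(2)] obtain t \<sigma>' where
        t: "t \<le> T" "(row_step P ^^ t) (a + 1, \<sigma>) = (a + 1 + len c, \<sigma>')" "I k \<sigma>'"
        by blast
      from Suc.IH[OF t(3)] obtain u \<sigma>'' where
        u: "u \<le> k * (T + 2) + 1" "(row_step P ^^ u) (a, \<sigma>') = (a + len (While b c), \<sigma>'')" "Q \<sigma>''"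
        by blast
      have "(row_step P ^^ 1) (a, \<sigma>) = (a + 1, \<sigma>)"
        using row_step_jump[OF P(1), of \<sigma>] True by simp
      moreover have "(row_step P ^^ 1) (a + 1 + len c, \<sigma>') = (a, \<sigma>')"
        using row_step_jump[OF P(3), of \<sigma>'] by simp
      ultimately have "(row_step P ^^ (1 + t + 1 + u)) (a, \<sigma>) = (a + len (While b c), \<sigma>'')"
        using t(2) u(2) funpow_trans by metis
      with t u show ?thesis
        by (intro exI[of _ "1 + t + 1 + u"] conjI exI[of _ \<sigma>'']) simp_all
    next
      case False
      with Suc.prems exit row_step_jump[OF P(1), of \<sigma>] show ?thesis
        by (intro exI[of _ 1] conjI exI[of _ \<sigma>]) simp_all
    qed
  qed
qed

section \<open>From programs to machines with finitely many tapes\<close>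

definition depends_below :: "nat \<Rightarrow> ((nat \<Rightarrow> nat) \<Rightarrow> 'b) \<Rightarrow> bool" where
  "depends_below k h \<longleftrightarrow> (\<forall>r r'. (\<forall>i<k. r i = r' i) \<longrightarrow> h r = h r')"

text \<open>The bound 4 is the number of symbols: blank, start mark and the two bits.\<close>

fun bounded_com :: "nat \<Rightarrow> com \<Rightarrow> bool" where
  "bounded_com k (Act g) \<longleftrightarrow> (\<forall>i x. x < 4 \<longrightarrow> fst (g i x) < 4)"
| "bounded_com k (Seq c d) \<longleftrightarrow> bounded_com k c \<and> bounded_com k d"
| "bounded_com k (If b c d) \<longleftrightarrow>
     depends_below k b \<and> bounded_com k c \<and> bounded_com k d"
| "bounded_com k (While b c) \<longleftrightarrow>
     depends_below k b \<and> bounded_com k c"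

definition bounded_row :: "nat \<Rightarrow> nat \<Rightarrow> row \<Rightarrow> bool" where
  "bounded_row k m f \<longleftrightarrow> depends_below k (fst \<circ> f) \<and> (\<forall>r. fst (f r) \<le> m) \<and>
     (\<forall>i<k. depends_below k (\<lambda>r. snd (f r) i) \<and> (\<forall>r. r i < 4 \<longrightarrow> fst (snd (f r) i) < 4))"

lemma depends_belowD: "depends_below k h \<Longrightarrow> (\<And>i. i < k \<Longrightarrow> r i = r' i) \<Longrightarrow> h r = h r'"
  unfolding depends_below_def by blast

lemma bounded_row_jump:
  assumes "depends_below k h" "\<And>r. h r \<le> m"
  shows "bounded_row k m (jump h)"
proof -
  have "depends_below k (\<lambda>r. (r i, Stay))" if "i < k" for i
    using that unfolding depends_below_def by blast
  moreover have "fst \<circ> jump h = h" by (auto simp: jump_def)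
  ultimately show ?thesis using assms by (simp add: bounded_row_def jump_def)
qed

lemma depends_below_if:
  assumes "depends_below k b" shows "depends_below k (\<lambda>r. if b r then x else y)"
  unfolding depends_below_def using depends_belowD[OF assms] by metis

lemma bounded_code:
  "bounded_com k c \<Longrightarrow> a + len c \<le> m \<Longrightarrow> f \<in> set (code a c) \<Longrightarrow> bounded_row k m f"
proof (induction c arbitrary: a f)
  case (Act g)
  have "depends_below k (\<lambda>r. g i (r i))" if "i < k" for i
    using that unfolding depends_below_def by metis
  moreover have "depends_below k (fst \<circ> f)"
    using Act.prems(3) by (simp add: depends_below_def)
  ultimately show ?case using Act.prems by (simp add: bounded_row_def)
next
  case (Seq c d)
  then show ?case using Seq.IH(1)[of a] Seq.IH(2)[of "a + len c"] by auto
next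
  case (If b c d)
  then have b: "depends_below k b" by simp
  consider "f = jump (\<lambda>r. if b r then a + 1 else a + len c + 2)" | "f \<in> set (code (a + 1) c)"
    | "f = jump (\<lambda>_. a + len c + len d + 2)" | "f \<in> set (code (a + len c + 2) d)"
    using If.prems(3) by auto
  then show ?case
  proof cases
    case 1
    show ?thesis unfolding 1
      using depends_below_if[OF b] If.prems(2) by (intro bounded_row_jump) auto
  next
    case 2
    with If.IH(1)[of "a + 1" f] If.prems show ?thesis by simp
  next
    case 3
    show ?thesis unfolding 3
      using If.prems(2) by (intro bounded_row_jump) (auto simp: depends_below_def)
  next
    case 4
    with If.IH(2)[of "a + len c + 2" f] If.prems show ?thesis by simp
  qed
next
  case (While b c)
  then have b: "depends_below k b" by simp
  consider "f = jump (\<lambda>r. if b r then a + 1 else a + len c + 2)" | "f \<in> set (code (a + 1) c)"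
    | "f = jump (\<lambda>_. a)"
    using While.prems(3) by auto
  then show ?case
  proof cases
    case 1
    show ?thesis unfolding 1
      using depends_below_if[OF b] While.prems(2) by (intro bounded_row_jump) auto
  next
    case 2
    with While.IH[of "a + 1" f] While.prems show ?thesis by simp
  next
    case 3
    show ?thesis unfolding 3
      using While.prems(2) by (intro bounded_row_jump) (auto simp: depends_below_def)
  qed
qed

text \<open>Tape 1 holds the answer at the end. The states \<open>len c + 1\<close> and
  \<open>len c + 2\<close> have no row, so \<open>row_step\<close> idles there just as
  \<open>tm_step\<close> does in halting states.\<close>

definition machine_rows :: "com \<Rightarrow> row list" where
  "machine_rows c = code 0 c @ [jump (\<lambda>r. if r 1 = 3 then len c + 1 else len c + 2)]"

definition machine :: "nat \<Rightarrow> com \<Rightarrow> tm" where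
  "machine k c = \<lparr>num_tapes = k, num_symbols = 4, num_states = len c + 3, initial = 0,
     accepting = len c + 1, rejecting = len c + 2,
     transition = (\<lambda>q xs. if q \<le> len c
       then let (q', acts) = (machine_rows c ! q) (\<lambda>i. xs ! i) in (q', map acts [0..<k])
       else (q, map (\<lambda>x. (x, Stay)) xs))\<rparr>"

lemma bounded_machine_rows:
  assumes "bounded_com k c" "2 \<le> k" "q \<le> len c"
  shows "bounded_row k (len c + 2) (machine_rows c ! q)"
proof (cases "q < len c")
  case True
  then have "code 0 c ! q \<in> set (code 0 c)" by simp
  then have "bounded_row k (len c + 2) (code 0 c ! q)"
    using bounded_code[OF assms(1), of 0 "len c + 2"] by simp
  with True show ?thesis by (simp add: machine_rows_def nth_append)
next
  case False
  with assms(3) have "machine_rows c ! q = jump (\<lambda>r. if r 1 = 3 then len c + 1 else len c + 2)"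
    by (simp add: machine_rows_def nth_append)
  moreover have "depends_below k (\<lambda>r. r 1 = 3)"
    using assms(2) by (simp add: depends_below_def)
  ultimately show ?thesis
    by (auto intro!: bounded_row_jump depends_below_if)
qed

lemma well_formed_machine:
  assumes "bounded_com k c" "2 \<le> k"
  shows "well_formed_tm (machine k c)"
proof -
  have "case transition (machine k c) q xs of (q', acts) \<Rightarrow>
      q' < len c + 3 \<and> length acts = k \<and> (\<forall>(y, d)\<in>set acts. y < 4)"
    if "q < len c + 3" "length xs = k" "\<forall>x\<in>set xs. x < 4" for q xs
  proof (cases "q \<le> len c")
    case True
    let ?f = "machine_rows c ! q" and ?r = "\<lambda>i. xs ! i"
    have "bounded_row k (len c + 2) ?f"
      using bounded_machine_rows assms True by blast
    then have "fst (?f ?r) \<le> len c + 2" "\<forall>i<k. fst (snd (?f ?r) i) < 4"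
      using that unfolding bounded_row_def by auto
    then have "\<forall>(y, d)\<in>set (map (snd (?f ?r)) [0..<k]). y < 4"
      by (metis (mono_tags, lifting) atLeastLessThan_iff case_prod_beta imageE list.set_map set_upt)
    moreover have "transition (machine k c) q xs = (fst (?f ?r), map (snd (?f ?r)) [0..<k])"
      using True by (simp add: machine_def Let_def case_prod_unfold)
    ultimately show ?thesis using \<open>fst (?f ?r) \<le> len c + 2\<close> by simp
  next
    case False
    with that show ?thesis by (auto simp: machine_def)
  qed
  with assms show ?thesis
    unfolding well_formed_tm_def by (simp add: machine_def)
qed

lemma tm_step_machine:
  assumes "bounded_com k c" "2 \<le> k" "q \<le> len c"
    and "row_step (machine_rows c) (q, \<sigma>) = (q', \<sigma>')"
  shows "tm_step (machine k c) (q, map \<sigma> [0..<k]) = (q', map \<sigma>' [0..<k])"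
proof -
  let ?f = "machine_rows c ! q" and ?r = "read_tape \<circ> \<sigma>"
    and ?r' = "\<lambda>i. map read_tape (map \<sigma> [0..<k]) ! i"
  have "\<forall>i<k. ?r' i = ?r i" by simp
  with bounded_machine_rows[OF assms(1-3)]
  have eq: "fst (?f ?r') = fst (?f ?r)" "\<forall>i<k. snd (?f ?r') i = snd (?f ?r) i"
    unfolding bounded_row_def by (auto dest!: depends_belowD[where r = ?r' and r' = ?r])
  have "q' = fst (?f ?r)" "\<sigma>' = (\<lambda>i. act_tape (snd (?f ?r) i) (\<sigma> i))"
    using assms(3,4)
    by (auto simp: row_step_def machine_rows_def Let_def split: prod.splits if_splits)
  moreover have "tm_step (machine k c) (q, map \<sigma> [0..<k]) =
      (fst (?f ?r'), map2 act_tape (map (snd (?f ?r')) [0..<k]) (map \<sigma> [0..<k]))"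
    using assms(3) by (simp add: tm_step_def machine_def Let_def case_prod_unfold)
  moreover have "map2 act_tape (map (snd (?f ?r')) [0..<k]) (map \<sigma> [0..<k]) =
      map (\<lambda>i. act_tape (snd (?f ?r) i) (\<sigma> i)) [0..<k]"
    using eq(2) by (intro nth_equalityI) auto
  ultimately show ?thesis using eq(1) by simp
qed

text \<open>The machine follows \<open>row_step\<close> on the first \<open>k\<close> tapes step by
  step, because bounded rows do not depend on the tapes beyond. The additional step is the final
  jump.\<close>

lemma machine_halts:
  assumes c: "bounded_com k c" and k: "2 \<le> k" and run: "run c \<sigma> T Q"
    and init: "initial_config (machine k c) w = (0, map \<sigma> [0..<k])"
    and Q: "\<And>\<sigma>'. Q \<sigma>' \<Longrightarrow> read_tape (\<sigma>' 1) = 3 \<longleftrightarrow> A"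
  shows "\<exists>t\<le>T + 1. state_after (machine k c) w t =
    (if A then accepting (machine k c) else rejecting (machine k c))"
proof -
  let ?P = "machine_rows c" and ?M = "machine k c"
  have P: "code_at ?P 0 (code 0 c)"
    "code_at ?P (len c) [jump (\<lambda>r. if r 1 = 3 then len c + 1 else len c + 2)]"
    unfolding machine_rows_def code_at_def by force+
  obtain t \<sigma>' where t: "t \<le> T" "(row_step ?P ^^ t) (0, \<sigma>) = (len c, \<sigma>')" "Q \<sigma>'"
    using run P(1) unfolding run_def by fastforce
  have sim: "(tm_step ?M ^^ u) (0, map \<sigma> [0..<k]) =
      (fst ((row_step ?P ^^ u) (0, \<sigma>)), map (snd ((row_step ?P ^^ u) (0, \<sigma>))) [0..<k]) \<and>
      fst ((row_step ?P ^^ u) (0, \<sigma>)) < len c + 3" for u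
  proof (induction u)
    case (Suc u)
    obtain q \<tau> where q: "(row_step ?P ^^ u) (0, \<sigma>) = (q, \<tau>)" by fastforce
    obtain q' \<tau>' where q': "row_step ?P (q, \<tau>) = (q', \<tau>')" by fastforce
    show ?case
    proof (cases "q \<le> len c")
      case True
      have "fst ((?P ! q) (read_tape \<circ> \<tau>)) \<le> len c + 2"
        using bounded_machine_rows[OF c k True] unfolding bounded_row_def by blast
      then have "q' < len c + 3"
        using q' True by (auto simp: row_step_def machine_rows_def Let_def split: prod.splits)
      with Suc q q' tm_step_machine[OF c k True q'] show ?thesis by simp
    next
      case False
      then have "q' = q" "\<tau>' = \<tau>"
        using q' by (auto simp: row_step_def machine_rows_def)
      moreover have "tm_step ?M (q, tps) = (q, tps)" for tps
        using False Suc q by (auto simp: tm_step_def machine_def)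
      ultimately show ?thesis using Suc q q' by simp
    qed
  qed simp
  have "fst ((row_step ?P ^^ Suc t) (0, \<sigma>)) =
      (if A then accepting ?M else rejecting ?M)"
    using row_step_jump[OF P(2), of \<sigma>'] t(2) Q[OF t(3)] by (simp add: machine_def)
  then have "state_after ?M w (Suc t) = (if A then accepting ?M else rejecting ?M)"
    using sim[of "Suc t"] by (simp add: state_after_def init)
  with t(1) show ?thesis by (intro exI[of _ "Suc t"]) auto
qed

section \<open>First-order formulas over the adjacency relation\<close>

definition left :: "nat set \<Rightarrow> com" where
  "left J = Act (\<lambda>i x. (x, if i \<in> J then Move_Left else Stay))"

definition right :: "nat set \<Rightarrow> com" where
  "right J = Act (\<lambda>i x. (x, if i \<in> J then Move_Right else Stay))"

definition overwrite :: "nat set \<Rightarrow> nat \<Rightarrow> com" where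
  "overwrite J y = Act (\<lambda>i x. (if i \<in> J then y else x, Stay))"

lemma run_right:
  "Q (\<lambda>i. if i \<in> J then (fst (\<sigma> i), snd (\<sigma> i) + 1) else \<sigma> i) \<Longrightarrow> run (right J) \<sigma> 1 Q"
  unfolding right_def
  by (rule run_Act, erule back_subst[of Q])
     (auto simp: act_all_def act_tape_def read_tape_def split: prod.splits)

lemma run_left:
  "Q (\<lambda>i. if i \<in> J then (fst (\<sigma> i), snd (\<sigma> i) - 1) else \<sigma> i) \<Longrightarrow> run (left J) \<sigma> 1 Q"
  unfolding left_def
  by (rule run_Act, erule back_subst[of Q])
     (auto simp: act_all_def act_tape_def read_tape_def split: prod.splits)

lemma run_overwrite:
  "Q (\<lambda>i. if i \<in> J then ((fst (\<sigma> i))(snd (\<sigma> i) := y), snd (\<sigma> i)) else \<sigma> i) \<Longrightarrow>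
   run (overwrite J y) \<sigma> 1 Q"
  unfolding overwrite_def
  by (rule run_Act, erule back_subst[of Q])
     (auto simp: act_all_def act_tape_def read_tape_def split: prod.splits)

lemma run_right1: "Q (\<sigma>(j := (fst (\<sigma> j), snd (\<sigma> j) + 1))) \<Longrightarrow> run (right {j}) \<sigma> 1 Q"
  by (rule run_right, erule back_subst[of Q]) auto

lemma run_left1: "Q (\<sigma>(j := (fst (\<sigma> j), snd (\<sigma> j) - 1))) \<Longrightarrow> run (left {j}) \<sigma> 1 Q"
  by (rule run_left, erule back_subst[of Q]) auto

lemma run_overwrite1:
  "Q (\<sigma>(j := ((fst (\<sigma> j))(snd (\<sigma> j) := y), snd (\<sigma> j)))) \<Longrightarrow> run (overwrite {j} y) \<sigma> 1 Q"
  by (rule run_overwrite, erule back_subst[of Q]) auto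

lemma read_tape_Pair [simp]: "read_tape (f, p) = f p"
  by (simp add: read_tape_def)

definition rewind :: "nat \<Rightarrow> com" where
  "rewind j = While (\<lambda>r. r j \<noteq> 1) (left {j})"

text \<open>The start mark occurs in cell 0 only and stops the loop. \<open>m\<close> is any bound
  on the head position and keeps the running time independent of it.\<close>

lemma run_rewind:
  assumes "\<sigma> j = (f, p)" "f 0 = 1" "\<And>q. 0 < q \<Longrightarrow> f q \<noteq> 1" "p \<le> m"
    and Q: "Q (\<sigma>(j := (f, 0)))"
  shows "run (rewind j) \<sigma> (m * 3 + 1) Q"
proof -
  have "run (While (\<lambda>r. r j \<noteq> 1) (left {j})) \<sigma> (p * (1 + 2) + 1) Q"
  proof (rule run_While[where I = "\<lambda>k \<tau>. \<tau> = \<sigma>(j := (f, k))"])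
    show "\<sigma> = \<sigma>(j := (f, p))" using assms(1) by auto
  next
    fix k \<tau> assume \<tau>: "\<tau> = \<sigma>(j := (f, k))" "(read_tape \<circ> \<tau>) j \<noteq> 1"
    with assms(2) obtain k' where "k = Suc k'" by (cases k) auto
    moreover have "run (left {j}) \<tau> 1 (\<lambda>\<tau>'. \<tau>' = \<sigma>(j := (f, k')))"
      by (rule run_left1) (simp add: \<tau>(1) \<open>k = Suc k'\<close>)
    ultimately show "\<exists>k'. k = Suc k' \<and> run (left {j}) \<tau> 1 (\<lambda>\<tau>'. \<tau>' = \<sigma>(j := (f, k')))"
      by blast
  next
    fix k \<tau> assume \<tau>: "\<tau> = \<sigma>(j := (f, k))" "\<not> (read_tape \<circ> \<tau>) j \<noteq> 1"
    with assms(3)[of k] have "k = 0" by auto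
    with \<tau> Q show "Q \<tau>" by simp
  qed
  then show ?thesis unfolding rewind_def by (rule run_mono) (use assms(4) in auto)
qed

text \<open>A tape holding a number \<open>x \<le> n\<close> consists of such a ruler with the head at cell \<open>x + 1\<close>.\<close>

definition ruler :: "nat \<Rightarrow> nat \<Rightarrow> nat" where
  "ruler n = (\<lambda>i. if i = 0 then 1 else if i = n + 1 then 2 else 0)"

text \<open>The loop counter is the tape itself: its head position is marked by symbol \<open>3\<close> and reached
  again when the loop ends.\<close>

definition repeat :: "nat \<Rightarrow> com \<Rightarrow> com" where
  "repeat a c = overwrite {a} 3 ;; rewind a ;; right {a} ;;
     While (\<lambda>r. r a \<noteq> 3) (right {a} ;; c) ;; overwrite {a} 0"

text \<open>The bracketing follows the nesting of the commands, so that \<open>run_Seq\<close>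
  matches it as it stands; the later time functions are written in the same way.\<close>

definition repeat_time :: "nat \<Rightarrow> nat \<Rightarrow> nat" where
  "repeat_time n T = 1 + ((n * 3 + 1) + (1 + ((n * (1 + T + 2) + 1) + 1)))"

text \<open>\<open>h\<close> is the effect of the body on the head of tape 0. The body runs while
  tape \<open>a\<close> carries the mark and serves as counter, so it has to work whatever tapes 0
  and \<open>a\<close> hold.\<close>

lemma run_repeat:
  assumes a: "\<sigma> a = (ruler n, x + 1)" "x < n" "a \<noteq> 0"
    and c: "\<And>\<tau>. (\<And>i. i \<noteq> 0 \<Longrightarrow> i \<noteq> a \<Longrightarrow> \<tau> i = \<sigma> i) \<Longrightarrow>
      run c \<tau> T (\<lambda>\<tau>'. \<tau>' = \<tau>(0 := (fst (\<tau> 0), h (snd (\<tau> 0)))))"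
    and Q: "Q (\<sigma>(0 := (fst (\<sigma> 0), (h ^^ x) (snd (\<sigma> 0)))))"
  shows "run (repeat a c) \<sigma> (repeat_time n T) Q"
proof -
  let ?g = "(ruler n)(x + 1 := 3)"
  define st where "st k = \<sigma>(a := (?g, k + 1), 0 := (fst (\<sigma> 0), (h ^^ k) (snd (\<sigma> 0))))" for k
  have step: "run (right {a} ;; c) (st k) (1 + T) (\<lambda>\<tau>. \<tau> = st (Suc k))" for k
  proof (rule run_Seq[where R = "\<lambda>\<tau>. \<tau> = (st k)(a := (?g, k + 2))"])
    show "run (right {a}) (st k) 1 (\<lambda>\<tau>. \<tau> = (st k)(a := (?g, k + 2)))"
      by (rule run_right1) (use a(3) in \<open>auto simp: st_def\<close>)
  next
    fix \<tau> assume \<tau>: "\<tau> = (st k)(a := (?g, k + 2))"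
    then have "run c \<tau> T (\<lambda>\<tau>'. \<tau>' = \<tau>(0 := (fst (\<tau> 0), h (snd (\<tau> 0)))))"
      by (intro c) (auto simp: st_def)
    then show "run c \<tau> T (\<lambda>\<tau>'. \<tau>' = st (Suc k))"
      by (rule run_mono) (use a(3) \<tau> in \<open>auto simp: st_def\<close>)
  qed
  have loop: "run (While (\<lambda>r. r a \<noteq> 3) (right {a} ;; c)) (st 0) (n * (1 + T + 2) + 1)
      (\<lambda>\<tau>. \<tau> = st x)"
  proof (rule run_mono)
    show "run (While (\<lambda>r. r a \<noteq> 3) (right {a} ;; c)) (st 0) (x * (1 + T + 2) + 1) (\<lambda>\<tau>. \<tau> = st x)"
    proof (rule run_While[where I = "\<lambda>k \<tau>. k \<le> x \<and> \<tau> = st (x - k)"])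
      fix k \<tau> assume \<tau>: "k \<le> x \<and> \<tau> = st (x - k)" and "(read_tape \<circ> \<tau>) a \<noteq> 3"
      with a(3) have "k \<noteq> 0" by (cases k) (auto simp: st_def)
      then obtain k' where k': "k = Suc k'" by (cases k) auto
      moreover have "run (right {a} ;; c) \<tau> (1 + T) (\<lambda>\<tau>. k' \<le> x \<and> \<tau> = st (x - k'))"
        using step[of "x - k"] \<tau> k' by (intro run_mono[OF step[of "x - k", folded conjunct2[OF \<tau>]]])
          (auto simp: Suc_diff_Suc)
      ultimately show "\<exists>k'. k = Suc k' \<and>
          run (right {a} ;; c) \<tau> (1 + T) (\<lambda>\<tau>. k' \<le> x \<and> \<tau> = st (x - k'))" by blast
    next
      fix k \<tau> assume \<tau>: "k \<le> x \<and> \<tau> = st (x - k)" and "\<not> (read_tape \<circ> \<tau>) a \<noteq> 3"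
      then have "x - k = x"
        using a(3) by (auto simp: st_def ruler_def split: if_splits)
      with \<tau> show "\<tau> = st x" by simp
    qed simp
    show "x * (1 + T + 2) + 1 \<le> n * (1 + T + 2) + 1"
      using a(2) by (intro add_mono mult_right_mono) auto
  qed simp
  have rew: "run (rewind a) (\<sigma>(a := (?g, x + 1))) (n * 3 + 1) (\<lambda>\<tau>. \<tau> = \<sigma>(a := (?g, 0)))"
    by (rule run_rewind[where f = ?g and p = "x + 1"]) (use a in \<open>auto simp: ruler_def\<close>)
  show ?thesis
    unfolding repeat_def repeat_time_def
  proof (rule run_Seq)
    show "run (overwrite {a} 3) \<sigma> 1 (\<lambda>\<tau>. \<tau> = \<sigma>(a := (?g, x + 1)))"
      by (rule run_overwrite1) (simp add: a(1))
    fix \<tau> assume \<tau>: "\<tau> = \<sigma>(a := (?g, x + 1))"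
    show "run (rewind a ;; right {a} ;; While (\<lambda>r. r a \<noteq> 3) (right {a} ;; c) ;; overwrite {a} 0)
      \<tau> ((n * 3 + 1) + (1 + ((n * (1 + T + 2) + 1) + 1))) Q"
    proof (intro run_Seq)
      show "run (rewind a) \<tau> (n * 3 + 1) (\<lambda>\<tau>. \<tau> = \<sigma>(a := (?g, 0)))"
        using rew \<tau> by simp
    next
      fix \<tau> assume "\<tau> = \<sigma>(a := (?g, 0))"
      then show "run (right {a}) \<tau> 1 (\<lambda>\<tau>. \<tau> = st 0)"
        by (intro run_right1) (use a(3) in \<open>auto simp: st_def\<close>)
    next
      fix \<tau> assume "\<tau> = st 0"
      with loop show "run (While (\<lambda>r. r a \<noteq> 3) (right {a} ;; c)) \<tau> (n * (1 + T + 2) + 1)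
        (\<lambda>\<tau>. \<tau> = st x)" by simp
    next
      fix \<tau> assume \<tau>: "\<tau> = st x"
      \<comment> \<open>As \<open>x < n\<close>, cell \<open>x + 1\<close> is blank on the ruler and
        not its end mark, so writing 0 undoes the marking.\<close>
      have "(ruler n)(x + 1 := 0) = ruler n" using a(2) by (auto simp: ruler_def)
      then have "\<tau>(a := ((fst (\<tau> a))(snd (\<tau> a) := 0), snd (\<tau> a))) =
          \<sigma>(0 := (fst (\<sigma> 0), (h ^^ x) (snd (\<sigma> 0))))"
        using \<tau> a by (auto simp: st_def)
      with Q show "run (overwrite {a} 0) \<tau> 1 Q" by (intro run_overwrite1) simp
    qed
  qed
qed

text \<open>The program does not know \<open>n\<close>: walking tape 2 from cell 1 to its end mark
  takes exactly \<open>n\<close> steps, and tape 0 moves along.\<close>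

definition skip_row :: com where
  "skip_row = right {2} ;; While (\<lambda>r. r 2 \<noteq> 2) (right {0} ;; right {2}) ;; rewind 2"

definition skip_row_time :: "nat \<Rightarrow> nat" where
  "skip_row_time n = 1 + ((n * (1 + 1 + 2) + 1) + ((n + 1) * 3 + 1))"

lemma run_skip_row:
  assumes "\<sigma> 2 = (ruler n, 0)"
  shows "run skip_row \<sigma> (skip_row_time n) (\<lambda>\<tau>. \<tau> = \<sigma>(0 := (fst (\<sigma> 0), snd (\<sigma> 0) + n)))"
proof -
  define st where "st k = \<sigma>(0 := (fst (\<sigma> 0), snd (\<sigma> 0) + k), 2 := (ruler n, k + 1))" for k
  show ?thesis
    unfolding skip_row_def skip_row_time_def
  proof (intro run_Seq)
    show "run (right {2}) \<sigma> 1 (\<lambda>\<tau>. \<tau> = st 0)"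
      by (rule run_right1) (auto simp: assms st_def)
    fix \<tau> assume "\<tau> = st 0"
    then show "run (While (\<lambda>r. r 2 \<noteq> 2) (right {0} ;; right {2})) \<tau> (n * (1 + 1 + 2) + 1)
        (\<lambda>\<tau>. \<tau> = st n)"
    proof (intro run_While[where I = "\<lambda>k \<tau>. k \<le> n \<and> \<tau> = st (n - k)"])
      fix k \<tau> assume \<tau>: "k \<le> n \<and> \<tau> = st (n - k)" and "(read_tape \<circ> \<tau>) 2 \<noteq> 2"
      then have "k \<noteq> 0" by (cases k) (auto simp: st_def ruler_def)
      then obtain k' where k': "k = Suc k'" by (cases k) auto
      have "run (right {0} ;; right {2}) \<tau> (1 + 1) (\<lambda>\<tau>. k' \<le> n \<and> \<tau> = st (n - k'))"
      proof (rule run_Seq)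
        show "run (right {0}) \<tau> 1 (\<lambda>\<tau>'. \<tau>' = \<tau>(0 := (fst (\<tau> 0), snd (\<tau> 0) + 1)))"
          by (rule run_right1) (rule refl)
        fix \<tau>' assume "\<tau>' = \<tau>(0 := (fst (\<tau> 0), snd (\<tau> 0) + 1))"
        then show "run (right {2}) \<tau>' 1 (\<lambda>\<tau>. k' \<le> n \<and> \<tau> = st (n - k'))"
          using \<tau> k' by (intro run_right1) (auto simp: st_def Suc_diff_Suc)
      qed
      with k' show "\<exists>k'. k = Suc k' \<and>
          run (right {0} ;; right {2}) \<tau> (1 + 1) (\<lambda>\<tau>. k' \<le> n \<and> \<tau> = st (n - k'))" by blast
    next
      fix k \<tau> assume \<tau>: "k \<le> n \<and> \<tau> = st (n - k)" and "\<not> (read_tape \<circ> \<tau>) 2 \<noteq> 2"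
      then have "n - k = n" by (auto simp: st_def ruler_def split: if_splits)
      with \<tau> show "\<tau> = st n" by simp
    qed simp
  next
    fix \<tau> assume "\<tau> = st n"
    then show "run (rewind 2) \<tau> ((n + 1) * 3 + 1) (\<lambda>\<tau>. \<tau> = \<sigma>(0 := (fst (\<sigma> 0), snd (\<sigma> 0) + n)))"
      by (intro run_rewind[where f = "ruler n" and p = "n + 1"]) (auto simp: st_def ruler_def assms)
  qed
qed

text \<open>Variables in formulas are de Bruijn levels: a quantifier below \<open>d\<close> others binds
  variable \<open>d\<close>.\<close>

datatype fm = Le nat nat | Adj nat nat | Neg fm | Conj fm fm | Exi fm

fun sat :: "nat \<Rightarrow> (nat \<Rightarrow> nat \<Rightarrow> bool) \<Rightarrow> nat \<Rightarrow> (nat \<Rightarrow> nat) \<Rightarrow> fm \<Rightarrow> bool" where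
  "sat n R d s (Le i j) \<longleftrightarrow> s i \<le> s j"
| "sat n R d s (Adj i j) \<longleftrightarrow> R (s i) (s j)"
| "sat n R d s (Neg F) \<longleftrightarrow> \<not> sat n R d s F"
| "sat n R d s (Conj F G) \<longleftrightarrow> sat n R d s F \<and> sat n R d s G"
| "sat n R d s (Exi F) \<longleftrightarrow> (\<exists>x<n. sat n R (Suc d) (s(d := x)) F)"

text \<open>\<open>V\<close> bounds the quantifier depth and thus the number of tapes kept for
  variables.\<close>

fun wf_fm :: "nat \<Rightarrow> nat \<Rightarrow> fm \<Rightarrow> bool" where
  "wf_fm V d (Le i j) \<longleftrightarrow> i < d \<and> j < d \<and> d \<le> V"
| "wf_fm V d (Adj i j) \<longleftrightarrow> i < d \<and> j < d \<and> d \<le> V"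
| "wf_fm V d (Neg F) \<longleftrightarrow> wf_fm V d F"
| "wf_fm V d (Conj F G) \<longleftrightarrow> wf_fm V d F \<and> wf_fm V d G"
| "wf_fm V d (Exi F) \<longleftrightarrow> d < V \<and> wf_fm V (Suc d) F"

lemma sat_cong:
  "wf_fm V d F \<Longrightarrow> (\<And>i. i < d \<Longrightarrow> s i = s' i) \<Longrightarrow> sat n R d s F = sat n R d s' F"
proof (induction F arbitrary: d s s')
  case (Exi F)
  have "sat n R (Suc d) (s(d := x)) F = sat n R (Suc d) (s'(d := x)) F" for x
    using Exi.prems by (intro Exi.IH) (auto simp: less_Suc_eq)
  then show ?case by simp
next
  case (Neg F)
  then show ?case by (metis sat.simps(3) wf_fm.simps(3))
next
  case (Conj F G)
  then have "sat n R d s F = sat n R d s' F" "sat n R d s G = sat n R d s' G"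
    by (metis wf_fm.simps(4))+
  then show ?case by simp
qed auto

section \<open>Evaluation of formulas by programs\<close>

definition set_flag :: "((nat \<Rightarrow> nat) \<Rightarrow> bool) \<Rightarrow> com" where
  "set_flag b = If b (overwrite {1} 3) (overwrite {1} 2)"

lemma run_set_flag:
  assumes "\<And>y. (b (read_tape \<circ> \<sigma>) \<longrightarrow> y = 3) \<Longrightarrow> (\<not> b (read_tape \<circ> \<sigma>) \<longrightarrow> y = 2) \<Longrightarrow>
    Q (\<sigma>(1 := ((fst (\<sigma> 1))(snd (\<sigma> 1) := y), snd (\<sigma> 1))))"
  shows "run (set_flag b) \<sigma> 3 Q"
proof (rule run_mono)
  show "run (set_flag b) \<sigma> (1 + 2) Q"
    unfolding set_flag_def by (rule run_If; rule run_overwrite1; rule assms; simp)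
qed simp_all

text \<open>Tape \<open>0\<close> carries the input, tape \<open>1\<close> the truth value (symbol \<open>3\<close> or \<open>2\<close>) of the formula
  evaluated last, tape \<open>2\<close> a ruler for skipping rows of the adjacency matrix, and tape \<open>i + 3\<close> the
  variable \<open>i\<close>. Numbers are compared by truncated subtraction on the head position of tape \<open>0\<close>.\<close>

fun compile :: "nat \<Rightarrow> fm \<Rightarrow> com" where
  "compile d (Le i j) = rewind 0 ;; repeat (i + 3) (right {0}) ;; repeat (j + 3) (left {0}) ;;
     set_flag (\<lambda>r. r 0 = 1)"
| "compile d (Adj i j) = rewind 0 ;; right {0} ;; repeat (i + 3) skip_row ;;
     repeat (j + 3) (right {0}) ;; set_flag (\<lambda>r. r 0 = 3)"
| "compile d (Neg F) = compile d F ;; set_flag (\<lambda>r. r 1 = 2)"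
| "compile d (Conj F G) = compile d F ;; If (\<lambda>r. r 1 = 3) (compile d G) (right {})"
| "compile d (Exi F) = rewind (d + 3) ;; right {d + 3} ;; overwrite {1} 2 ;;
     While (\<lambda>r. r 1 = 2 \<and> r (d + 3) \<noteq> 2) (compile (Suc d) F ;; right {d + 3})"

fun fm_time :: "nat \<Rightarrow> fm \<Rightarrow> nat" where
  "fm_time n (Le i j) =
     ((n * n + 1) * 3 + 1) + (repeat_time n 1 + (repeat_time n 1 + 3))"
| "fm_time n (Adj i j) = ((n * n + 1) * 3 + 1) +
     (1 + (repeat_time n (skip_row_time n) + (repeat_time n 1 + 3)))"
| "fm_time n (Neg F) = fm_time n F + 3"
| "fm_time n (Conj F G) = fm_time n F + ((fm_time n G + 1) + 2)"
| "fm_time n (Exi F) = ((n + 1) * 3 + 1) + (1 + (1 + (n * (fm_time n F + 1 + 2) + 1)))"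

definition encodes :: "nat \<Rightarrow> (nat \<Rightarrow> nat \<Rightarrow> bool) \<Rightarrow> (nat \<Rightarrow> nat) \<Rightarrow> bool" where
  "encodes n R f \<longleftrightarrow> f 0 = 1 \<and> (\<forall>q>0. f q \<noteq> 1) \<and>
     (\<forall>u<n. \<forall>v<n. f (u * n + v + 1) = 3 \<longleftrightarrow> R u v)"

definition holds ::
  "nat \<Rightarrow> (nat \<Rightarrow> nat) \<Rightarrow> nat \<Rightarrow> (nat \<Rightarrow> nat) \<Rightarrow> (nat \<Rightarrow> tape) \<Rightarrow> bool" where
  "holds n f V s \<sigma> \<longleftrightarrow> fst (\<sigma> 0) = f \<and> snd (\<sigma> 0) \<le> n * n + 1 \<and> \<sigma> 2 = (ruler n, 0) \<and>
     (\<forall>i<V. s i \<le> n \<and> \<sigma> (i + 3) = (ruler n, s i + 1))"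

lemma add_funpow: "((\<lambda>p :: nat. p + k) ^^ x) p = p + x * k"
  by (induction x) auto

lemma diff_funpow: "((\<lambda>p :: nat. p - 1) ^^ x) p = p - x"
  by (induction x) auto

lemma cell_bound: "x < n \<Longrightarrow> y < n \<Longrightarrow> x * n + y + 1 \<le> n * (n :: nat)"
proof -
  assume "x < n" "y < n"
  then have "Suc x * n \<le> n * n" by (intro mult_right_mono) auto
  with \<open>y < n\<close> show ?thesis by simp
qed

text \<open>Only the variables below \<open>d\<close> are promised to be unchanged: an inner
  quantifier leaves its own variable wherever the search stopped, and every quantifier rewinds its
  tape before use.\<close>

lemma run_compile:
  assumes enc: "encodes n R f"
  shows "holds n f V s \<sigma> \<Longrightarrow> wf_fm V d F \<Longrightarrow> (\<And>i. i < d \<Longrightarrow> s i < n) \<Longrightarrow>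
    run (compile d F) \<sigma> (fm_time n F) (\<lambda>\<sigma>'.
      (\<exists>s'. holds n f V s' \<sigma>' \<and> (\<forall>i<d. s' i = s i)) \<and>
      read_tape (\<sigma>' 1) = (if sat n R d s F then 3 else 2))"
proof (induction F arbitrary: d s \<sigma>)
  case (Le i j)
  have \<sigma>: "\<sigma> 0 = (f, snd (\<sigma> 0))" "snd (\<sigma> 0) \<le> n * n + 1" "\<sigma> (i + 3) = (ruler n, s i + 1)"
    "\<sigma> (j + 3) = (ruler n, s j + 1)" "s i < n" "s j < n"
    using Le by (auto simp: holds_def prod_eq_iff)
  have f: "f 0 = 1" "\<And>q. 0 < q \<Longrightarrow> f q \<noteq> 1" using enc by (auto simp: encodes_def)
  show ?case
    unfolding compile.simps fm_time.simps
  proof (intro run_Seq)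
    show "run (rewind 0) \<sigma> ((n * n + 1) * 3 + 1) (\<lambda>\<tau>. \<tau> = \<sigma>(0 := (f, 0)))"
      by (rule run_rewind[where f = f and p = "snd (\<sigma> 0)"]) (use \<sigma> f in auto)
  next
    fix \<tau> assume "\<tau> = \<sigma>(0 := (f, 0))"
    then show "run (repeat (i + 3) (right {0})) \<tau> (repeat_time n 1) (\<lambda>\<tau>. \<tau> = \<sigma>(0 := (f, s i)))"
      using \<sigma> by (intro run_repeat[where h = "\<lambda>p. p + 1" and x = "s i"] run_right1)
        (auto simp: add_funpow[where k = 1, simplified])
  next
    fix \<tau> assume "\<tau> = \<sigma>(0 := (f, s i))"
    then show "run (repeat (j + 3) (left {0})) \<tau> (repeat_time n 1)
        (\<lambda>\<tau>. \<tau> = \<sigma>(0 := (f, s i - s j)))"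
      using \<sigma> by (intro run_repeat[where h = "\<lambda>p. p - 1" and x = "s j"] run_left1)
        (auto simp: diff_funpow[simplified])
  next
    fix \<tau> assume \<tau>: "\<tau> = \<sigma>(0 := (f, s i - s j))"
    have "f (s i - s j) = 1 \<longleftrightarrow> s i \<le> s j" using f by (metis diff_is_0_eq neq0_conv)
    moreover have "s i - s j \<le> n * n + 1"
      using \<sigma>(5) le_square[of n] by linarith
    ultimately show "run (set_flag (\<lambda>r. r 0 = 1)) \<tau> 3 (\<lambda>\<sigma>'.
      (\<exists>s'. holds n f V s' \<sigma>' \<and> (\<forall>i<d. s' i = s i)) \<and>
      read_tape (\<sigma>' 1) = (if sat n R d s (Le i j) then 3 else 2))"
      using Le.prems(1) \<tau> by (intro run_set_flag conjI exI[of _ s]) (auto simp: holds_def)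
  qed
next
  case (Adj i j)
  have \<sigma>: "\<sigma> 0 = (f, snd (\<sigma> 0))" "snd (\<sigma> 0) \<le> n * n + 1" "\<sigma> (i + 3) = (ruler n, s i + 1)"
    "\<sigma> (j + 3) = (ruler n, s j + 1)" "s i < n" "s j < n" "\<sigma> 2 = (ruler n, 0)"
    using Adj by (auto simp: holds_def prod_eq_iff)
  have f: "f 0 = 1" "\<And>q. 0 < q \<Longrightarrow> f q \<noteq> 1" using enc by (auto simp: encodes_def)
  show ?case
    unfolding compile.simps fm_time.simps
  proof (intro run_Seq)
    show "run (rewind 0) \<sigma> ((n * n + 1) * 3 + 1) (\<lambda>\<tau>. \<tau> = \<sigma>(0 := (f, 0)))"
      by (rule run_rewind[where f = f and p = "snd (\<sigma> 0)"]) (use \<sigma> f in auto)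
  next
    fix \<tau> assume "\<tau> = \<sigma>(0 := (f, 0))"
    then show "run (right {0}) \<tau> 1 (\<lambda>\<tau>. \<tau> = \<sigma>(0 := (f, 1)))"
      by (intro run_right1) auto
  next
    fix \<tau> assume "\<tau> = \<sigma>(0 := (f, 1))"
    then show "run (repeat (i + 3) skip_row) \<tau> (repeat_time n (skip_row_time n))
        (\<lambda>\<tau>. \<tau> = \<sigma>(0 := (f, 1 + s i * n)))"
      using \<sigma> by (intro run_repeat[where h = "\<lambda>p. p + n" and x = "s i"] run_skip_row)
        (auto simp: add_funpow)
  next
    fix \<tau> assume "\<tau> = \<sigma>(0 := (f, 1 + s i * n))"
    then show "run (repeat (j + 3) (right {0})) \<tau> (repeat_time n 1)
        (\<lambda>\<tau>. \<tau> = \<sigma>(0 := (f, s i * n + s j + 1)))"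
      using \<sigma> by (intro run_repeat[where h = "\<lambda>p. p + 1" and x = "s j"] run_right1)
        (auto simp: add_funpow[where k = 1, simplified])
  next
    fix \<tau> assume \<tau>: "\<tau> = \<sigma>(0 := (f, s i * n + s j + 1))"
    have "f (s i * n + s j + 1) = 3 \<longleftrightarrow> R (s i) (s j)"
      using enc \<sigma> unfolding encodes_def by blast
    with cell_bound[OF \<sigma>(5,6)] show "run (set_flag (\<lambda>r. r 0 = 3)) \<tau> 3 (\<lambda>\<sigma>'.
      (\<exists>s'. holds n f V s' \<sigma>' \<and> (\<forall>i<d. s' i = s i)) \<and>
      read_tape (\<sigma>' 1) = (if sat n R d s (Adj i j) then 3 else 2))"
      using Adj.prems(1) \<tau> by (intro run_set_flag conjI exI[of _ s]) (auto simp: holds_def)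
  qed
next
  case (Neg F)
  have "wf_fm V d F" using Neg.prems(2) by simp
  show ?case
    unfolding compile.simps fm_time.simps
  proof (rule run_Seq[OF Neg.IH[OF Neg.prems(1) \<open>wf_fm V d F\<close> Neg.prems(3)]])
    fix \<tau> assume \<tau>: "(\<exists>s'. holds n f V s' \<tau> \<and> (\<forall>i<d. s' i = s i)) \<and>
      read_tape (\<tau> 1) = (if sat n R d s F then 3 else 2)"
    then obtain s' where "holds n f V s' \<tau>" "\<forall>i<d. s' i = s i" by blast
    with \<tau> show "run (set_flag (\<lambda>r. r 1 = 2)) \<tau> 3 (\<lambda>\<sigma>'.
      (\<exists>s'. holds n f V s' \<sigma>' \<and> (\<forall>i<d. s' i = s i)) \<and>
      read_tape (\<sigma>' 1) = (if sat n R d s (Neg F) then 3 else 2))"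
      by (intro run_set_flag conjI exI[of _ s']) (auto simp: holds_def)
  qed
next
  case (Conj F G)
  have wf: "wf_fm V d F" "wf_fm V d G" using Conj.prems(2) by simp_all
  show ?case
    unfolding compile.simps fm_time.simps
  proof (rule run_Seq[OF Conj.IH(1)[OF Conj.prems(1) wf(1) Conj.prems(3)]])
    fix \<tau> assume \<tau>: "(\<exists>s'. holds n f V s' \<tau> \<and> (\<forall>i<d. s' i = s i)) \<and>
      read_tape (\<tau> 1) = (if sat n R d s F then 3 else 2)"
    then obtain s' where s': "holds n f V s' \<tau>" "\<forall>i<d. s' i = s i" by blast
    show "run (If (\<lambda>r. r 1 = 3) (compile d G) (right {})) \<tau> (fm_time n G + 1 + 2) (\<lambda>\<sigma>'.
      (\<exists>s'. holds n f V s' \<sigma>' \<and> (\<forall>i<d. s' i = s i)) \<and>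
      read_tape (\<sigma>' 1) = (if sat n R d s (Conj F G) then 3 else 2))" (is "run _ _ _ ?Q")
    proof (rule run_If)
      assume "(read_tape \<circ> \<tau>) 1 = 3"
      with \<tau> have F: "sat n R d s F" by (auto split: if_splits)
      have G: "sat n R d s' G = sat n R d s G" using sat_cong[OF wf(2)] s'(2) by blast
      have "s' i < n" if "i < d" for i using that s'(2) Conj.prems(3) by simp
      from Conj.IH(2)[OF s'(1) wf(2) this]
      show "run (compile d G) \<tau> (fm_time n G + 1) ?Q"
        by (rule run_mono) (use F G s'(2) in auto)
    next
      \<comment> \<open>The flag is already 2, so the idle step \<open>right {}\<close>
        suffices.\<close>
      assume "(read_tape \<circ> \<tau>) 1 \<noteq> 3"
      with \<tau> s' have "?Q \<tau>" by auto
      then have "run (right {}) \<tau> 1 ?Q" by (intro run_right) simp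
      then show "run (right {}) \<tau> (fm_time n G + 1) ?Q" by (rule run_mono) auto
    qed
  qed
next
  case (Exi F)
  have wf: "d < V" "wf_fm V (Suc d) F" using Exi.prems(2) by simp_all
  define a where "a = d + 3"
  have \<sigma>: "\<sigma> a = (ruler n, s d + 1)" "s d \<le> n"
    using Exi.prems(1) wf(1) by (auto simp: holds_def a_def)
  have a: "a \<noteq> 0" "a \<noteq> 1" "a \<noteq> 2" by (auto simp: a_def)
  \<comment> \<open>\<open>k\<close> values are still untried, the next one being
    \<open>n - k\<close>; the flag remembers whether a smaller one was a witness. The search may
    stop with \<open>k > 0\<close>.\<close>
  define inv where "inv k \<tau> \<longleftrightarrow> k \<le> n \<and>
    (\<exists>s'. holds n f V s' \<tau> \<and> (\<forall>i<d. s' i = s i) \<and> s' d = n - k) \<and>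
    read_tape (\<tau> 1) = (if \<exists>x < n - k. sat n R (Suc d) (s(d := x)) F then 3 else 2)" for k \<tau>
  show ?case
    unfolding compile.simps fm_time.simps a_def[symmetric]
  proof (intro run_Seq)
    show "run (rewind a) \<sigma> ((n + 1) * 3 + 1) (\<lambda>\<tau>. \<tau> = \<sigma>(a := (ruler n, 0)))"
      by (rule run_rewind[where f = "ruler n" and p = "s d + 1"])
        (use \<sigma> in \<open>auto simp: ruler_def\<close>)
  next
    fix \<tau> assume "\<tau> = \<sigma>(a := (ruler n, 0))"
    then show "run (right {a}) \<tau> 1 (\<lambda>\<tau>. \<tau> = \<sigma>(a := (ruler n, 1)))"
      by (intro run_right1) auto
  next
    fix \<tau> assume \<tau>: "\<tau> = \<sigma>(a := (ruler n, 1))"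
    show "run (overwrite {1} 2) \<tau> 1 (inv n)"
      unfolding inv_def using Exi.prems(1) wf(1) \<tau> a
      by (intro run_overwrite1 conjI exI[of _ "s(d := 0)"]) (auto simp: holds_def a_def)
  next
    fix \<tau> assume "inv n \<tau>"
    then show "run (While (\<lambda>r. r 1 = 2 \<and> r a \<noteq> 2) (compile (Suc d) F ;; right {a})) \<tau>
      (n * (fm_time n F + 1 + 2) + 1) (\<lambda>\<sigma>'.
      (\<exists>s'. holds n f V s' \<sigma>' \<and> (\<forall>i<d. s' i = s i)) \<and>
      read_tape (\<sigma>' 1) = (if sat n R d s (Exi F) then 3 else 2))"
    proof (rule run_While[where I = inv])
      fix k \<tau> assume inv: "inv k \<tau>" and cond: "(read_tape \<circ> \<tau>) 1 = 2 \<and> (read_tape \<circ> \<tau>) a \<noteq> 2"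
      obtain s' where s': "holds n f V s' \<tau>" "\<forall>i<d. s' i = s i" "s' d = n - k" and "k \<le> n"
        using inv by (auto simp: inv_def)
      have no: "\<not> (\<exists>x < n - k. sat n R (Suc d) (s(d := x)) F)"
        using inv cond by (auto simp: inv_def split: if_splits)
      have "\<tau> a = (ruler n, n - k + 1)" using s' wf(1) by (auto simp: holds_def a_def)
      with cond have "k \<noteq> 0" by (cases k) (auto simp: ruler_def)
      then obtain k' where k': "k = Suc k'" by (cases k) auto
      have eq: "sat n R (Suc d) s' F = sat n R (Suc d) (s(d := n - k)) F"
        using s' by (intro sat_cong[OF wf(2)]) (auto simp: less_Suc_eq)
      have nk: "n - k' = Suc (n - k)" using k' \<open>k \<le> n\<close> by simp
      have "s' i < n" if "i < Suc d" for i
        using that s' Exi.prems(3) k' \<open>k \<le> n\<close> by (auto simp: less_Suc_eq)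
      note IH = Exi.IH[OF s'(1) wf(2) this]
      have "run (compile (Suc d) F ;; right {a}) \<tau> (fm_time n F + 1) (inv k')"
      proof (rule run_Seq[OF IH])
        fix \<tau>' assume \<tau>': "(\<exists>s''. holds n f V s'' \<tau>' \<and> (\<forall>i<Suc d. s'' i = s' i)) \<and>
          read_tape (\<tau>' 1) = (if sat n R (Suc d) s' F then 3 else 2)"
        then obtain s'' where s'': "holds n f V s'' \<tau>'" "\<forall>i<Suc d. s'' i = s' i" by blast
        have "(\<exists>x < n - k'. sat n R (Suc d) (s(d := x)) F) = sat n R (Suc d) s' F"
          using no eq unfolding nk by (auto simp: less_Suc_eq)
        with \<tau>' a have flag: "read_tape ((\<tau>'(a := (ruler n, n - k' + 1))) 1) =
            (if \<exists>x < n - k'. sat n R (Suc d) (s(d := x)) F then 3 else 2)" by simp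
        \<comment> \<open>The evaluation one level deeper preserves all variables below
          \<open>Suc d\<close>, so variable \<open>d\<close> is intact and can be advanced.\<close>
        have "\<tau>'(a := (fst (\<tau>' a), snd (\<tau>' a) + 1)) = \<tau>'(a := (ruler n, n - k' + 1))"
          using s'' s' wf(1) nk by (auto simp: holds_def a_def)
        moreover have "holds n f V (s''(d := n - k')) (\<tau>'(a := (ruler n, n - k' + 1)))"
          using s''(1) a by (auto simp: holds_def a_def)
        ultimately have "inv k' (\<tau>'(a := (fst (\<tau>' a), snd (\<tau>' a) + 1)))"
          unfolding inv_def using flag s'' s' k' \<open>k \<le> n\<close>
          by (intro conjI exI[of _ "s''(d := n - k')"]) auto
        then show "run (right {a}) \<tau>' 1 (inv k')" by (rule run_right1)
      qed
      with k' show "\<exists>k'. k = Suc k' \<and>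
          run (compile (Suc d) F ;; right {a}) \<tau> (fm_time n F + 1) (inv k')" by blast
    next
      fix k \<tau> assume inv: "inv k \<tau>"
        and cond: "\<not> ((read_tape \<circ> \<tau>) 1 = 2 \<and> (read_tape \<circ> \<tau>) a \<noteq> 2)"
      obtain s' where s': "holds n f V s' \<tau>" "\<forall>i<d. s' i = s i" "s' d = n - k"
        using inv by (auto simp: inv_def)
      have \<tau>a: "\<tau> a = (ruler n, n - k + 1)" using s' wf(1) by (auto simp: holds_def a_def)
      \<comment> \<open>Exit means that all \<open>n\<close> values were tried or that a witness was
        found.\<close>
      have "(\<exists>x < n - k. sat n R (Suc d) (s(d := x)) F) = (\<exists>x < n. sat n R (Suc d) (s(d := x)) F)"
      proof (cases "read_tape (\<tau> 1) = 2")
        case True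
        with cond \<tau>a have "n - k = n" by (auto simp: ruler_def split: if_splits)
        then show ?thesis by simp
      next
        case False
        with inv have "\<exists>x < n - k. sat n R (Suc d) (s(d := x)) F"
          by (auto simp: inv_def split: if_splits)
        then show ?thesis using less_le_trans[of _ "n - k" n] by auto
      qed
      with inv s' show "(\<exists>s'. holds n f V s' \<tau> \<and> (\<forall>i<d. s' i = s i)) \<and>
          read_tape (\<tau> 1) = (if sat n R d s (Exi F) then 3 else 2)"
        by (auto simp: inv_def)
    qed
  qed
qed

text \<open>The input does not show where a row ends: \<open>n\<close> is found from the length \<open>n * n\<close> by walking
  over \<open>1, 3, 5, \<dots>\<close> cells until the end of the word.\<close>

definition setup_com :: "nat \<Rightarrow> com" where
  "setup_com V = right {0} ;;
     While (\<lambda>r. r 0 \<noteq> 0)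
       (While (\<lambda>r. r 2 \<noteq> 1) (left {2..<V + 3} ;; right {0, 1}) ;;
        While (\<lambda>r. r 1 \<noteq> 1) (left {1} ;; right ({0} \<union> {2..<V + 3})) ;;
        right ({0} \<union> {2..<V + 3})) ;;
     right {2..<V + 3} ;; overwrite {2..<V + 3} 2 ;; rewind 2"

definition setup_time :: "nat \<Rightarrow> nat" where
  "setup_time n = 1 + ((n * ((n * (2 + 2) + 1) + ((n * (2 + 2) + 1) + 1) + 2) + 1) +
     (1 + (1 + ((n + 1) * 3 + 1))))"

text \<open>Round \<open>m\<close> starts with the tapes from 2 on at cell \<open>m\<close> and the
  input head at \<open>m * m + 1\<close>. Emptying these tapes into the counter on tape 1 and
  filling them again moves the input head by \<open>m\<close> each time; with one further step it
  reaches the position for \<open>m + 1\<close>. It is beyond the word exactly from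
  \<open>m = n\<close> on.\<close>

lemma run_setup:
  assumes f: "f 0 = 1" "\<And>q. 0 < q \<Longrightarrow> f q \<noteq> 1" "\<And>q. 0 < q \<Longrightarrow> f q = 0 \<longleftrightarrow> n * n < q"
    and \<sigma>: "\<sigma> 0 = (f, 0)" "\<And>i. 0 < i \<Longrightarrow> i < V + 3 \<Longrightarrow> \<sigma> i = (\<lambda>q. if q = 0 then 1 else 0, 0)"
  shows "run (setup_com V) \<sigma> (setup_time n) (holds n f V (\<lambda>_. n))"
proof -
  let ?J = "{2..<V + 3}" and ?e = "\<lambda>q. if q = 0 then 1 else 0 :: nat"
  define st where
    "st m j p = (\<lambda>i. if i = 0 then (f, p) else if i = 1 then (?e, j) else
       if i \<in> ?J then (?e, m) else \<sigma> i)" for m j p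
  have down: "run (While (\<lambda>r. r 2 \<noteq> 1) (left ?J ;; right {0, 1})) (st m 0 p) (n * (2 + 2) + 1)
      (\<lambda>\<tau>. \<tau> = st 0 m (p + m))" if "m \<le> n" for m p
  proof (rule run_mono)
    show "run (While (\<lambda>r. r 2 \<noteq> 1) (left ?J ;; right {0, 1})) (st m 0 p) (m * (2 + 2) + 1)
      (\<lambda>\<tau>. \<tau> = st 0 m (p + m))"
    proof (rule run_While[where I = "\<lambda>k \<tau>. k \<le> m \<and> \<tau> = st k (m - k) (p + (m - k))"])
      fix k \<tau> assume \<tau>: "k \<le> m \<and> \<tau> = st k (m - k) (p + (m - k))"
        and "(read_tape \<circ> \<tau>) 2 \<noteq> 1"
      then have "k \<noteq> 0" by (cases k) (auto simp: st_def)
      then obtain k' where k': "k = Suc k'" by (cases k) auto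
      have "run (left ?J ;; right {0, 1}) \<tau> (1 + 1)
          (\<lambda>\<tau>. k' \<le> m \<and> \<tau> = st k' (m - k') (p + (m - k')))"
      proof (rule run_Seq)
        show "run (left ?J) \<tau> 1 (\<lambda>\<tau>'. \<tau>' = st k' (m - k) (p + (m - k)))"
          by (rule run_left) (use \<tau> k' in \<open>auto simp: st_def\<close>)
        fix \<tau>' assume "\<tau>' = st k' (m - k) (p + (m - k))"
        then show "run (right {0, 1}) \<tau>' 1
            (\<lambda>\<tau>. k' \<le> m \<and> \<tau> = st k' (m - k') (p + (m - k')))"
          by (intro run_right) (use \<tau> k' in \<open>auto simp: st_def Suc_diff_Suc\<close>)
      qed
      with k' show "\<exists>k'. k = Suc k' \<and> run (left ?J ;; right {0, 1}) \<tau> 2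
          (\<lambda>\<tau>. k' \<le> m \<and> \<tau> = st k' (m - k') (p + (m - k')))" by (simp add: numeral_2_eq_2)
    next
      fix k \<tau> assume \<tau>: "k \<le> m \<and> \<tau> = st k (m - k) (p + (m - k))"
        and "\<not> (read_tape \<circ> \<tau>) 2 \<noteq> 1"
      then have "k = 0" by (auto simp: st_def split: if_splits)
      with \<tau> show "\<tau> = st 0 m (p + m)" by simp
    qed simp
  qed (use that in auto)
  have up: "run (While (\<lambda>r. r 1 \<noteq> 1) (left {1} ;; right ({0} \<union> ?J))) (st 0 m p) (n * (2 + 2) + 1)
      (\<lambda>\<tau>. \<tau> = st m 0 (p + m))" if "m \<le> n" for m p
  proof (rule run_mono)
    show "run (While (\<lambda>r. r 1 \<noteq> 1) (left {1} ;; right ({0} \<union> ?J))) (st 0 m p) (m * (2 + 2) + 1)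
      (\<lambda>\<tau>. \<tau> = st m 0 (p + m))"
    proof (rule run_While[where I = "\<lambda>k \<tau>. k \<le> m \<and> \<tau> = st (m - k) k (p + (m - k))"])
      fix k \<tau> assume \<tau>: "k \<le> m \<and> \<tau> = st (m - k) k (p + (m - k))"
        and "(read_tape \<circ> \<tau>) 1 \<noteq> 1"
      then have "k \<noteq> 0" by (cases k) (auto simp: st_def)
      then obtain k' where k': "k = Suc k'" by (cases k) auto
      have "run (left {1} ;; right ({0} \<union> ?J)) \<tau> (1 + 1)
          (\<lambda>\<tau>. k' \<le> m \<and> \<tau> = st (m - k') k' (p + (m - k')))"
      proof (rule run_Seq)
        show "run (left {1}) \<tau> 1 (\<lambda>\<tau>'. \<tau>' = st (m - k) k' (p + (m - k)))"
          by (rule run_left) (use \<tau> k' in \<open>auto simp: st_def\<close>)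
        fix \<tau>' assume "\<tau>' = st (m - k) k' (p + (m - k))"
        then show "run (right ({0} \<union> ?J)) \<tau>' 1
            (\<lambda>\<tau>. k' \<le> m \<and> \<tau> = st (m - k') k' (p + (m - k')))"
          by (intro run_right) (use \<tau> k' in \<open>auto simp: st_def Suc_diff_Suc\<close>)
      qed
      with k' show "\<exists>k'. k = Suc k' \<and> run (left {1} ;; right ({0} \<union> ?J)) \<tau> 2
          (\<lambda>\<tau>. k' \<le> m \<and> \<tau> = st (m - k') k' (p + (m - k')))" by (simp add: numeral_2_eq_2)
    next
      fix k \<tau> assume \<tau>: "k \<le> m \<and> \<tau> = st (m - k) k (p + (m - k))"
        and "\<not> (read_tape \<circ> \<tau>) 1 \<noteq> 1"
      then have "k = 0" by (auto simp: st_def split: if_splits)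
      with \<tau> show "\<tau> = st m 0 (p + m)" by simp
    qed simp
  qed (use that in auto)
  show ?thesis
    unfolding setup_com_def setup_time_def
  proof (intro run_Seq)
    show "run (right {0}) \<sigma> 1 (\<lambda>\<tau>. \<tau> = st 0 0 1)"
      by (rule run_right1) (use \<sigma> in \<open>auto simp: st_def\<close>)
  next
    fix \<tau> assume "\<tau> = st 0 0 1"
    then show "run (While (\<lambda>r. r 0 \<noteq> 0)
       (While (\<lambda>r. r 2 \<noteq> 1) (left ?J ;; right {0, 1}) ;;
        While (\<lambda>r. r 1 \<noteq> 1) (left {1} ;; right ({0} \<union> ?J)) ;; right ({0} \<union> ?J))) \<tau>
       (n * ((n * (2 + 2) + 1) + ((n * (2 + 2) + 1) + 1) + 2) + 1)
       (\<lambda>\<tau>. \<tau> = st n 0 (n * n + 1))"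
    proof (intro run_While[where
          I = "\<lambda>k \<tau>. k \<le> n \<and> \<tau> = st (n - k) 0 ((n - k) * (n - k) + 1)"])
      fix k \<tau> assume \<tau>: "k \<le> n \<and> \<tau> = st (n - k) 0 ((n - k) * (n - k) + 1)"
        and "(read_tape \<circ> \<tau>) 0 \<noteq> 0"
      then have "k \<noteq> 0" using f(3)[of "n * n + 1"] by (cases k) (auto simp: st_def)
      then obtain k' where k': "k = Suc k'" by (cases k) auto
      define m where "m = n - k"
      have m: "m \<le> n" "n - k' = Suc m" using \<tau> k' by (auto simp: m_def)
      have "run (While (\<lambda>r. r 2 \<noteq> 1) (left ?J ;; right {0, 1}) ;;
        While (\<lambda>r. r 1 \<noteq> 1) (left {1} ;; right ({0} \<union> ?J)) ;; right ({0} \<union> ?J)) \<tau>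
        ((n * (2 + 2) + 1) + ((n * (2 + 2) + 1) + 1))
        (\<lambda>\<tau>. k' \<le> n \<and> \<tau> = st (n - k') 0 ((n - k') * (n - k') + 1))"
      proof (intro run_Seq)
        show "run (While (\<lambda>r. r 2 \<noteq> 1) (left ?J ;; right {0, 1})) \<tau> (n * (2 + 2) + 1)
            (\<lambda>\<tau>. \<tau> = st 0 m (m * m + 1 + m))"
          unfolding conjunct2[OF \<tau>] m_def[symmetric] by (rule down[OF m(1)])
      next
        fix \<tau> assume \<tau>': "\<tau> = st 0 m (m * m + 1 + m)"
        show "run (While (\<lambda>r. r 1 \<noteq> 1) (left {1} ;; right ({0} \<union> ?J))) \<tau> (n * (2 + 2) + 1)
            (\<lambda>\<tau>. \<tau> = st m 0 (m * m + 1 + m + m))"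
          unfolding \<tau>' by (rule up[OF m(1)])
      next
        fix \<tau>' assume "\<tau>' = st m 0 (m * m + 1 + m + m)"
        then show "run (right ({0} \<union> ?J)) \<tau>' 1
            (\<lambda>\<tau>. k' \<le> n \<and> \<tau> = st (n - k') 0 ((n - k') * (n - k') + 1))"
          by (intro run_right) (use \<tau> k' in \<open>auto simp: st_def m(2)\<close>)
      qed
      with k' show "\<exists>k'. k = Suc k' \<and> run (While (\<lambda>r. r 2 \<noteq> 1) (left ?J ;; right {0, 1}) ;;
        While (\<lambda>r. r 1 \<noteq> 1) (left {1} ;; right ({0} \<union> ?J)) ;; right ({0} \<union> ?J)) \<tau>
        ((n * (2 + 2) + 1) + ((n * (2 + 2) + 1) + 1))
        (\<lambda>\<tau>. k' \<le> n \<and> \<tau> = st (n - k') 0 ((n - k') * (n - k') + 1))" by blast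
    next
      fix k \<tau> assume \<tau>: "k \<le> n \<and> \<tau> = st (n - k) 0 ((n - k) * (n - k) + 1)"
        and "\<not> (read_tape \<circ> \<tau>) 0 \<noteq> 0"
      then have "f ((n - k) * (n - k) + 1) = 0" by (simp add: st_def)
      then have "n * n \<le> (n - k) * (n - k)" using f(3)[of "(n - k) * (n - k) + 1"] by simp
      then have "n \<le> n - k" by (metis le0 mult_mono' not_le mult_strict_mono')
      then have "n - k = n" by simp
      with \<tau> show "\<tau> = st n 0 (n * n + 1)" by simp
    qed simp
  next
    fix \<tau> assume "\<tau> = st n 0 (n * n + 1)"
    then show "run (right ?J) \<tau> 1 (\<lambda>\<tau>. \<tau> = st (n + 1) 0 (n * n + 1))"
      by (intro run_right) (auto simp: st_def)
  next
    \<comment> \<open>The heads now stand at the place of the end mark. Only tape 2 is rewound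
      afterwards, so all variables start with the value \<open>n\<close>.\<close>
    fix \<tau> assume "\<tau> = st (n + 1) 0 (n * n + 1)"
    moreover have "?e(n + 1 := 2) = ruler n" by (auto simp: ruler_def)
    ultimately show "run (overwrite ?J 2) \<tau> 1 (\<lambda>\<tau>. fst (\<tau> 0) = f \<and> snd (\<tau> 0) = n * n + 1 \<and>
        (\<forall>i\<in>?J. \<tau> i = (ruler n, n + 1)))"
      by (intro run_overwrite) (auto simp: st_def)
  next
    fix \<tau> assume "fst (\<tau> 0) = f \<and> snd (\<tau> 0) = n * n + 1 \<and> (\<forall>i\<in>?J. \<tau> i = (ruler n, n + 1))"
    then show "run (rewind 2) \<tau> ((n + 1) * 3 + 1) (holds n f V (\<lambda>_. n))"
      by (intro run_rewind[where f = "ruler n" and p = "n + 1"]) (auto simp: holds_def ruler_def)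
  qed
qed

lemma bounded_setup: "bounded_com (V + 3) (setup_com V)"
  by (auto simp: setup_com_def right_def left_def overwrite_def rewind_def depends_below_def)

lemma bounded_compile: "wf_fm V d F \<Longrightarrow> bounded_com (V + 3) (compile d F)"
  by (induction F arbitrary: d)
     (auto simp: right_def left_def overwrite_def rewind_def repeat_def skip_row_def set_flag_def
       depends_below_def)

section \<open>Polynomial bounds and the decision of first-order properties\<close>

definition poly_fun :: "(nat \<Rightarrow> nat) \<Rightarrow> bool" where
  "poly_fun g \<longleftrightarrow> (\<exists>p. \<forall>n. g n = poly p n)"

lemma poly_fun_intros:
  "poly_fun (\<lambda>n. c)" "poly_fun (\<lambda>n. n)"
  "poly_fun g \<Longrightarrow> poly_fun h \<Longrightarrow> poly_fun (\<lambda>n. g n + h n)"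
  "poly_fun g \<Longrightarrow> poly_fun h \<Longrightarrow> poly_fun (\<lambda>n. g n * h n)"
proof -
  show "poly_fun (\<lambda>n. c)" unfolding poly_fun_def by (intro exI[of _ "[:c:]"]) simp
  show "poly_fun (\<lambda>n. n)" unfolding poly_fun_def by (intro exI[of _ "[:0, 1:]"]) simp
  show "poly_fun (\<lambda>n. g n + h n)" if "poly_fun g" "poly_fun h"
    using that unfolding poly_fun_def by (metis poly_add)
  show "poly_fun (\<lambda>n. g n * h n)" if "poly_fun g" "poly_fun h"
    using that unfolding poly_fun_def by (metis poly_mult)
qed

lemma poly_fun_Suc: "poly_fun g \<Longrightarrow> poly_fun (\<lambda>n. Suc (g n))"
  using poly_fun_intros(3)[of g "\<lambda>n. 1"] poly_fun_intros(1) by simp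

lemma poly_fun_fm_time: "poly_fun (\<lambda>n. fm_time n F)"
  by (induction F) (auto simp: repeat_time_def skip_row_time_def intro!: poly_fun_intros poly_fun_Suc)

lemma poly_fun_setup_time: "poly_fun setup_time"
  unfolding setup_time_def by (intro poly_fun_intros)

text \<open>All coefficients are natural numbers, so no term can decrease.\<close>

lemma poly_nat_mono: "m \<le> n \<Longrightarrow> poly p m \<le> poly p (n :: nat)" for p :: "nat poly"
  by (induction p) (auto intro!: add_mono mult_mono)

lemma length_concat_map_const:
  "(\<And>x. x \<in> set xs \<Longrightarrow> length (g x) = k) \<Longrightarrow> length (concat (map g xs)) = length xs * k"
  by (induction xs) auto

lemma nth_concat_map_const:
  "(\<And>x. x \<in> set xs \<Longrightarrow> length (g x) = k) \<Longrightarrow> u < length xs \<Longrightarrow> v < k \<Longrightarrow>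
   concat (map g xs) ! (u * k + v) = g (xs ! u) ! v"
proof (induction xs arbitrary: u)
  case (Cons x xs)
  then show ?case by (cases u) (auto simp: nth_append)
qed simp

lemma length_adjacency_string: "length (adjacency_string n E) = n * n"
  unfolding adjacency_string_def by (subst length_concat_map_const[where k = n]) auto

lemma nth_adjacency_string:
  "u < n \<Longrightarrow> v < n \<Longrightarrow> adjacency_string n E ! (u * n + v) \<longleftrightarrow> {u, v} \<in> E"
  unfolding adjacency_string_def by (subst nth_concat_map_const[where k = n]) auto

text \<open>The machine depends on the formula alone. Its running time is a polynomial in the number
  \<open>n\<close> of vertices, and \<open>n\<close> is at most the word length
  \<open>n * n\<close>. Evaluation begins with the environment constantly \<open>n\<close> left by
  the set-up.\<close>

theorem poly_time_first_order:
  assumes wf: "wf_fm V 0 F"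
    and F: "\<And>n E s. (n, E) \<in> I \<Longrightarrow> sat n (\<lambda>u v. {u, v} \<in> E) 0 s F \<longleftrightarrow> Q (n, E)"
  shows "poly_time_solvable_on I (\<lambda>(n, E). adjacency_string n E) Q"
proof -
  define c where "c = setup_com V ;; compile 0 F"
  let ?M = "machine (V + 3) c"
  have c: "bounded_com (V + 3) c"
    using bounded_setup bounded_compile[OF wf] by (simp add: c_def)
  have "poly_fun (\<lambda>n. setup_time n + fm_time n F + 1)"
    by (intro poly_fun_intros poly_fun_setup_time poly_fun_fm_time)
  then obtain p where p: "\<And>n. setup_time n + fm_time n F + 1 = poly p n"
    unfolding poly_fun_def by blast
  have "\<exists>t \<le> poly p (length (adjacency_string n E)). state_after ?M (adjacency_string n E) t =
      (if Q (n, E) then accepting ?M else rejecting ?M)" if I: "(n, E) \<in> I" for n E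
  proof -
    let ?w = "adjacency_string n E" and ?R = "\<lambda>u v. {u, v} \<in> E"
    define f where "f = fst (initial_tape ?w)"
    define \<sigma> where "\<sigma> i = (if i = 0 then initial_tape ?w else initial_tape [])" for i :: nat
    have f: "f q = (if q = 0 then 1 else if q \<le> n * n then if ?w ! (q - 1) then 3 else 2 else 0)" for q
      by (auto simp: f_def initial_tape_def length_adjacency_string start_symbol_def
        blank_symbol_def bit_symbol_def)
    have "encodes n ?R f"
      unfolding encodes_def
    proof (intro conjI allI impI)
      fix u v assume uv: "u < n" "v < n"
      have "u * n + v + 1 \<le> n * n" using cell_bound[OF uv] by simp
      then show "f (u * n + v + 1) = 3 \<longleftrightarrow> {u, v} \<in> E"
        using nth_adjacency_string[OF uv] by (simp add: f)
    qed (auto simp: f)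
    have \<sigma>0: "\<sigma> 0 = (f, 0)" by (simp add: \<sigma>_def f_def initial_tape_def)
    have \<sigma>1: "\<sigma> i = (\<lambda>q. if q = 0 then 1 else 0, 0)" if "0 < i" for i
      using that
      by (auto simp: \<sigma>_def initial_tape_def start_symbol_def blank_symbol_def fun_eq_iff)
    have run: "run c \<sigma> (setup_time n + fm_time n F) (\<lambda>\<sigma>'.
        read_tape (\<sigma>' 1) = (if sat n ?R 0 (\<lambda>_. n) F then 3 else 2))"
      unfolding c_def
    proof (rule run_Seq)
      show "run (setup_com V) \<sigma> (setup_time n) (holds n f V (\<lambda>_. n))"
        by (rule run_setup)
           (auto simp: f \<sigma>0 \<sigma>1)
      fix \<tau> assume "holds n f V (\<lambda>_. n) \<tau>"
      from run_compile[OF \<open>encodes n ?R f\<close> this wf]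
      show "run (compile 0 F) \<tau> (fm_time n F) (\<lambda>\<sigma>'.
        read_tape (\<sigma>' 1) = (if sat n ?R 0 (\<lambda>_. n) F then 3 else 2))"
        by (rule run_mono) auto
    qed
    have init: "initial_config ?M ?w = (0, map \<sigma> [0..<V + 3])"
    proof -
      have "map \<sigma> [0..<V + 3] = \<sigma> 0 # map \<sigma> [1..<V + 3]" by (simp add: upt_conv_Cons)
      also have "map \<sigma> [1..<V + 3] = replicate (V + 2) (initial_tape [])"
        by (rule replicate_eqI) (auto simp: \<sigma>_def)
      finally have "map \<sigma> [0..<V + 3] = \<sigma> 0 # replicate (V + 2) (initial_tape [])" .
      moreover have "\<sigma> 0 = initial_tape ?w" by (simp add: \<sigma>_def)
      moreover have "initial ?M = 0" "num_tapes ?M - 1 = V + 2" by (simp_all add: machine_def)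
      ultimately show ?thesis by (simp only: initial_config_def)
    qed
    have "\<exists>t \<le> setup_time n + fm_time n F + 1. state_after ?M ?w t =
        (if sat n ?R 0 (\<lambda>_. n) F then accepting ?M else rejecting ?M)"
      by (rule machine_halts[OF c _ run init]) auto
    moreover have "poly p n \<le> poly p (length ?w)"
      by (rule poly_nat_mono) (simp add: length_adjacency_string)
    ultimately show ?thesis
      using F[OF I, of "\<lambda>_. n"] p[of n] by (auto intro: le_trans)
  qed
  moreover have "well_formed_tm ?M" by (rule well_formed_machine[OF c]) simp
  ultimately show ?thesis
    unfolding poly_time_solvable_on_def by fastforce
qed

section \<open>A first-order formula for localizability\<close>

text \<open>\<open>Le 0 0\<close> serves as truth. It mentions variable 0, hence the condition
  \<open>0 < d\<close> in the well-formedness lemmas.\<close>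

fun conjs :: "fm list \<Rightarrow> fm" where
  "conjs [] = Le 0 0"
| "conjs (F # Fs) = Conj F (conjs Fs)"

definition disjs :: "fm list \<Rightarrow> fm" where
  "disjs Fs = Neg (conjs (map Neg Fs))"

definition exs :: "nat \<Rightarrow> fm \<Rightarrow> fm" where
  "exs k F = (Exi ^^ k) F"

definition eq_fm :: "nat \<Rightarrow> nat \<Rightarrow> fm" where
  "eq_fm i j = Conj (Le i j) (Le j i)"

definition mem_fm :: "nat \<Rightarrow> nat list \<Rightarrow> fm" where
  "mem_fm i xs = disjs (map (eq_fm i) xs)"

definition eqs_fm :: "nat list \<Rightarrow> nat list \<Rightarrow> fm" where
  "eqs_fm xs ys = conjs (map (\<lambda>x. mem_fm x ys) xs @ map (\<lambda>y. mem_fm y xs) ys)"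

definition disjoint_fm :: "nat list \<Rightarrow> nat list \<Rightarrow> fm" where
  "disjoint_fm xs ys = conjs (map (\<lambda>x. Neg (mem_fm x ys)) xs)"

text \<open>This is \<open>strong_iff\<close> for the set named by \<open>xs\<close>. A dominating
  independent set is thinned out to one neighbour per entry: the quantified variable
  \<open>d + i\<close> is a neighbour of entry \<open>i\<close>. Entries may name the same vertex,
  hence the equality in the clique condition.\<close>

definition strong_fm :: "nat \<Rightarrow> nat list \<Rightarrow> fm" where
  "strong_fm d xs = (let ys = [d..<d + length xs] in
     Conj (conjs [disjs [eq_fm x y, Adj x y]. x \<leftarrow> xs, y \<leftarrow> xs])
       (Neg (exs (length xs) (conjs ([Neg (Adj y z). y \<leftarrow> ys, z \<leftarrow> ys] @
         map (\<lambda>y. Neg (mem_fm y xs)) ys @ map (\<lambda>i. Adj (d + i) (xs ! i)) [0..<length xs])))))"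

lemma sat_conjs: "sat n R d s (conjs Fs) \<longleftrightarrow> (\<forall>F\<in>set Fs. sat n R d s F)"
  by (induction Fs) auto

lemma sat_disjs: "sat n R d s (disjs Fs) \<longleftrightarrow> (\<exists>F\<in>set Fs. sat n R d s F)"
  by (simp add: disjs_def sat_conjs)

text \<open>Nested quantifiers become the choice of one environment, so that a block of variables
  can be read as the set of its values.\<close>

lemma sat_exs: "sat n R d s (exs k F) \<longleftrightarrow>
  (\<exists>s'. (\<forall>i. i < d \<or> d + k \<le> i \<longrightarrow> s' i = s i) \<and> (\<forall>i. d \<le> i \<and> i < d + k \<longrightarrow> s' i < n) \<and>
    sat n R (d + k) s' F)"
proof (induction k arbitrary: d s)
  case 0
  have "(\<forall>i. i < d \<or> d + 0 \<le> i \<longrightarrow> s' i = s i) \<longleftrightarrow> s' = s" for s' by force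
  then show ?case by (simp add: exs_def)
next
  case (Suc k)
  have agree: "(\<exists>x<n. (\<forall>i. i < Suc d \<or> Suc d + k \<le> i \<longrightarrow> s' i = (s(d := x)) i) \<and>
        (\<forall>i. Suc d \<le> i \<and> i < Suc d + k \<longrightarrow> s' i < n)) \<longleftrightarrow>
      (\<forall>i. i < d \<or> d + Suc k \<le> i \<longrightarrow> s' i = s i) \<and> (\<forall>i. d \<le> i \<and> i < d + Suc k \<longrightarrow> s' i < n)"
    (is "?L = ?R") for s'
  proof
    assume ?L
    then obtain x where x: "x < n" "\<forall>i. i < Suc d \<or> Suc d + k \<le> i \<longrightarrow> s' i = (s(d := x)) i"
      "\<forall>i. Suc d \<le> i \<and> i < Suc d + k \<longrightarrow> s' i < n" by blast
    show ?R
    proof (intro conjI allI impI)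
      fix i assume "i < d \<or> d + Suc k \<le> i"
      then show "s' i = s i" using x(2)[rule_format, of i] by auto
    next
      fix i assume "d \<le> i \<and> i < d + Suc k"
      then show "s' i < n" using x(1,3) x(2)[rule_format, of i] by (cases "i = d") auto
    qed
  next
    assume R: ?R
    show ?L
      by (rule exI[of _ "s' d"]) (use R in \<open>auto simp: less_Suc_eq\<close>)
  qed
  have "sat n R d s (exs (Suc k) F) \<longleftrightarrow> (\<exists>x<n. sat n R (Suc d) (s(d := x)) (exs k F))"
    by (simp add: exs_def)
  also have "\<dots> \<longleftrightarrow> (\<exists>s'. (\<exists>x<n. (\<forall>i. i < Suc d \<or> Suc d + k \<le> i \<longrightarrow> s' i = (s(d := x)) i) \<and>
        (\<forall>i. Suc d \<le> i \<and> i < Suc d + k \<longrightarrow> s' i < n)) \<and> sat n R (Suc d + k) s' F)"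
    unfolding Suc.IH by blast
  finally show ?case unfolding agree by simp
qed

lemma sat_eq_fm: "sat n R d s (eq_fm i j) \<longleftrightarrow> s i = s j"
  by (auto simp: eq_fm_def)

lemma sat_mem_fm: "sat n R d s (mem_fm i xs) \<longleftrightarrow> s i \<in> s ` set xs"
  by (auto simp: mem_fm_def sat_disjs sat_eq_fm)

lemma sat_eqs_fm: "sat n R d s (eqs_fm xs ys) \<longleftrightarrow> s ` set xs = s ` set ys"
  unfolding set_eq_subset
  by (auto simp: eqs_fm_def sat_conjs sat_mem_fm ball_Un image_subset_iff)

lemma sat_disjoint_fm: "sat n R d s (disjoint_fm xs ys) \<longleftrightarrow> s ` set xs \<inter> s ` set ys = {}"
  by (auto simp: disjoint_fm_def sat_conjs sat_mem_fm)

lemmas sat_simps = sat_conjs sat_disjs sat_eq_fm sat_mem_fm sat_eqs_fm sat_disjoint_fm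

lemma wf_conjs: "0 < d \<Longrightarrow> d \<le> V \<Longrightarrow> (\<And>F. F \<in> set Fs \<Longrightarrow> wf_fm V d F) \<Longrightarrow> wf_fm V d (conjs Fs)"
  by (induction Fs) auto

lemma wf_disjs: "0 < d \<Longrightarrow> d \<le> V \<Longrightarrow> (\<And>F. F \<in> set Fs \<Longrightarrow> wf_fm V d F) \<Longrightarrow> wf_fm V d (disjs Fs)"
  by (auto simp: disjs_def intro!: wf_conjs)

lemma wf_exs: "d + k \<le> V \<Longrightarrow> wf_fm V (d + k) F \<Longrightarrow> wf_fm V d (exs k F)"
  by (induction k arbitrary: d) (auto simp: exs_def)

lemma wf_eq_fm: "i < d \<Longrightarrow> j < d \<Longrightarrow> d \<le> V \<Longrightarrow> wf_fm V d (eq_fm i j)"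
  by (simp add: eq_fm_def)

lemma wf_mem_fm: "i < d \<Longrightarrow> \<forall>x\<in>set xs. x < d \<Longrightarrow> d \<le> V \<Longrightarrow> wf_fm V d (mem_fm i xs)"
  unfolding mem_fm_def by (rule wf_disjs) (auto intro: wf_eq_fm)

lemma wf_eqs_fm:
  "0 < d \<Longrightarrow> \<forall>x\<in>set xs. x < d \<Longrightarrow> \<forall>y\<in>set ys. y < d \<Longrightarrow> d \<le> V \<Longrightarrow> wf_fm V d (eqs_fm xs ys)"
  unfolding eqs_fm_def by (rule wf_conjs) (auto intro!: wf_mem_fm)

lemma wf_disjoint_fm:
  "0 < d \<Longrightarrow> \<forall>x\<in>set xs. x < d \<Longrightarrow> \<forall>y\<in>set ys. y < d \<Longrightarrow> d \<le> V \<Longrightarrow> wf_fm V d (disjoint_fm xs ys)"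
  unfolding disjoint_fm_def by (rule wf_conjs) (auto intro!: wf_mem_fm)

lemma wf_strong_fm:
  assumes "0 < d" "\<forall>x\<in>set xs. x < d" "d + length xs \<le> V"
  shows "wf_fm V d (strong_fm d xs)"
proof -
  have xs: "\<forall>x\<in>set xs. x < d + length xs" using assms(2) by auto
  then have nth: "xs ! i < d + length xs" if "i < length xs" for i using that by simp
  have "wf_fm V d (conjs [disjs [eq_fm x y, Adj x y]. x \<leftarrow> xs, y \<leftarrow> xs])"
    using assms by (auto intro!: wf_conjs wf_disjs wf_eq_fm)
  moreover have "wf_fm V (d + length xs) (conjs (
      [Neg (Adj y z). y \<leftarrow> [d..<d + length xs], z \<leftarrow> [d..<d + length xs]] @
      map (\<lambda>y. Neg (mem_fm y xs)) [d..<d + length xs] @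
      map (\<lambda>i. Adj (d + i) (xs ! i)) [0..<length xs]))"
    using assms xs nth by (intro wf_conjs) (auto intro!: wf_mem_fm)
  ultimately show ?thesis
    using assms(3) by (simp add: strong_fm_def Let_def wf_exs)
qed

lemma ball_less: "(\<forall>i\<in>{0..<k :: nat}. Q i) \<longleftrightarrow> (\<forall>i<k. Q i)"
  and bex_less: "(\<exists>i\<in>{0..<k :: nat}. Q i) \<longleftrightarrow> (\<exists>i<k. Q i)"
  by auto

lemma sat_strong_fm:
  assumes "subcubic_graph {..<n} E" and xs: "\<And>x. x \<in> set xs \<Longrightarrow> x < d \<and> s x < n"
  shows "sat n (\<lambda>u v. {u, v} \<in> E) d s (strong_fm d xs) \<longleftrightarrow>
    strong_clique {..<n} E (s ` set xs)"
proof -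
  interpret subcubic_graph "{..<n}" E by fact
  let ?k = "length xs" and ?C = "s ` set xs"
  let ?ys = "{d..<d + ?k}"
  have C: "?C \<subseteq> {..<n}" using xs by auto
  have "(\<exists>s'. (\<forall>i. i < d \<or> d + ?k \<le> i \<longrightarrow> s' i = s i) \<and> (\<forall>i. d \<le> i \<and> i < d + ?k \<longrightarrow> s' i < n) \<and>
      (\<forall>y\<in>?ys. \<forall>z\<in>?ys. {s' y, s' z} \<notin> E) \<and> (\<forall>y\<in>?ys. s' y \<notin> s' ` set xs) \<and>
      (\<forall>i<?k. {s' (d + i), s' (xs ! i)} \<in> E)) \<longleftrightarrow>
    (\<exists>I. indep I E \<and> I \<inter> ?C = {} \<and> (\<forall>c\<in>?C. I \<inter> N c \<noteq> {}))" (is "?L = ?R")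
  proof
    assume ?L
    then obtain s' where s': "\<forall>i. i < d \<or> d + ?k \<le> i \<longrightarrow> s' i = s i"
      "\<forall>y\<in>?ys. \<forall>z\<in>?ys. {s' y, s' z} \<notin> E" "\<forall>y\<in>?ys. s' y \<notin> s' ` set xs"
      "\<forall>i<?k. {s' (d + i), s' (xs ! i)} \<in> E" by blast
    have eq: "s' x = s x" if "x \<in> set xs" for x using s'(1) xs[OF that] by simp
    then have im: "s' ` set xs = ?C" by simp
    show ?R
    proof (intro exI conjI ballI)
      show "indep (s' ` ?ys) E" using s'(2) by (auto simp: indep_iff nbs_def)
      show "s' ` ?ys \<inter> ?C = {}" using s'(3) im by blast
      fix c assume "c \<in> ?C"
      then obtain i where i: "i < ?k" "c = s (xs ! i)" by (auto simp: in_set_conv_nth)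
      then have "{s' (d + i), s' (xs ! i)} \<in> E" using s'(4) by blast
      then have "s' (d + i) \<in> N c" using i eq[of "xs ! i"] by (simp add: nbs_def)
      moreover have "s' (d + i) \<in> s' ` ?ys" using i(1) by simp
      ultimately show "s' ` ?ys \<inter> N c \<noteq> {}" by blast
    qed
  next
    assume ?R
    then obtain I where I: "indep I E" "I \<inter> ?C = {}" "\<forall>c\<in>?C. I \<inter> N c \<noteq> {}" by blast
    then have "\<forall>c\<in>?C. \<exists>y. y \<in> I \<inter> N c" by blast
    from bchoice[OF this] obtain g where "\<forall>c\<in>?C. g c \<in> I \<inter> N c" ..
    then have g: "g c \<in> I" "g c \<in> N c" if "c \<in> ?C" for c using that by blast+
    \<comment> \<open>The quantified variable \<open>i\<close> takes the neighbour, inside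
      \<open>I\<close>, of the vertex named by entry \<open>i - d\<close>.\<close>
    define s' where "s' i = (if d \<le> i \<and> i < d + ?k then g (s (xs ! (i - d))) else s i)" for i
    have eq: "s' x = s x" if "x \<in> set xs" for x using xs[OF that] by (simp add: s'_def)
    then have im: "s' ` set xs = ?C" by simp
    have mem: "s (xs ! (i - d)) \<in> ?C" if "i \<in> ?ys" for i
      using that by (intro imageI nth_mem) auto
    have sI: "s' i \<in> I" if "i \<in> ?ys" for i
      using g(1)[OF mem[OF that]] that by (simp add: s'_def)
    show ?L
    proof (intro exI[of _ s'] conjI allI ballI impI)
      fix i assume "d \<le> i \<and> i < d + ?k"
      then have "i \<in> ?ys" by simp
      then have "s' i \<in> N (s (xs ! (i - d)))" using g(2)[OF mem[of i]] by (simp add: s'_def)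
      then show "s' i < n" using N_subset by blast
    next
      fix y z assume "y \<in> ?ys" "z \<in> ?ys"
      then show "{s' y, s' z} \<notin> E" using sI I(1) by (auto simp: indep_iff nbs_def)
    next
      fix y assume "y \<in> ?ys"
      then show "s' y \<notin> s' ` set xs" using sI I(2) im by blast
    next
      fix i assume i: "i < ?k"
      then have "s' (d + i) \<in> N (s (xs ! i))"
        using g(2)[of "s (xs ! i)"] by (simp add: s'_def)
      then show "{s' (d + i), s' (xs ! i)} \<in> E"
        using eq[of "xs ! i"] i by (simp add: nbs_def)
    qed (auto simp: s'_def)
  qed
  moreover have "sat n (\<lambda>u v. {u, v} \<in> E) d s (strong_fm d xs) \<longleftrightarrow>
      (\<forall>x\<in>set xs. \<forall>y\<in>set xs. s x = s y \<or> {s x, s y} \<in> E) \<and>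
      \<not> (\<exists>s'. (\<forall>i. i < d \<or> d + ?k \<le> i \<longrightarrow> s' i = s i) \<and>
      (\<forall>i. d \<le> i \<and> i < d + ?k \<longrightarrow> s' i < n) \<and>
      (\<forall>y\<in>?ys. \<forall>z\<in>?ys. {s' y, s' z} \<notin> E) \<and> (\<forall>y\<in>?ys. s' y \<notin> s' ` set xs) \<and>
      (\<forall>i<?k. {s' (d + i), s' (xs ! i)} \<in> E))"
    unfolding strong_fm_def Let_def by (simp add: sat_exs sat_simps ball_Un ball_less bex_less)
  moreover have "(\<forall>x\<in>set xs. \<forall>y\<in>set xs. s x = s y \<or> {s x, s y} \<in> E) \<longleftrightarrow> clique ?C E"
    by (auto simp: clique_def)
  ultimately show ?thesis using C by (simp add: strong_iff)
qed

text \<open>The variable \<open>0\<close> stands for \<open>v\<close>, the three blocks of four variables for the sets \<open>c i\<close> in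
  \<open>localizable_iff\<close>, and the variables \<open>13, \<dots>, 16\<close> for \<open>D\<close>.\<close>

definition block :: "nat \<Rightarrow> nat list" where
  "block i = [4 * i + 1..<4 * i + 5]"

definition localizable_fm :: fm where
  "localizable_fm = Neg (exs 13 (conjs
     [conjs [disjs [mem_fm 0 (block i), strong_fm 13 (block i)]. i \<leftarrow> [0..<3]],
      conjs [disjs [mem_fm 0 (block i), mem_fm 0 (block j), eqs_fm (block i) (block j),
        disjoint_fm (block i) (block j)]. i \<leftarrow> [0..<3], j \<leftarrow> [0..<3]],
      Neg (exs 4 (conjs [strong_fm 17 (block 3), mem_fm 0 (block 3),
        conjs [disjs [mem_fm 0 (block i), disjoint_fm (block i) (block 3)]. i \<leftarrow> [0..<3]]]))]))"

lemma set_block: "set (block i) = {4 * i + 1..<4 * i + 5}"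
  by (simp add: block_def)

lemma set_block_3: "set (block 3) = {13..<17}"
  by (simp add: set_block)

text \<open>21 is 17 + 4: after \<open>v\<close>, the three blocks and \<open>D\<close>, the formula
  \<open>strong_fm 17\<close> binds four further vertices. The quantifiers inside
  \<open>strong_fm 13\<close> stay below 17.\<close>

lemma wf_localizable_fm: "wf_fm 21 0 localizable_fm"
proof -
  have b: "\<forall>x\<in>set (block i). x < 13" "\<forall>x\<in>set (block i). x < 17" "length (block i) = 4"
    if "i < 3" for i using that by (auto simp: block_def)
  have b3: "\<forall>x\<in>set (block 3). x < 17" "length (block 3) = 4" by (auto simp: block_def)
  have "wf_fm 21 13 (conjs [disjs [mem_fm 0 (block i), strong_fm 13 (block i)]. i \<leftarrow> [0..<3]])"
    (is "wf_fm 21 13 ?A")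
    by (intro wf_conjs) (auto simp: b intro!: wf_disjs wf_mem_fm wf_strong_fm)
  moreover have "wf_fm 21 13 (conjs [disjs [mem_fm 0 (block i), mem_fm 0 (block j),
      eqs_fm (block i) (block j), disjoint_fm (block i) (block j)]. i \<leftarrow> [0..<3], j \<leftarrow> [0..<3]])"
    (is "wf_fm 21 13 ?B")
    by (intro wf_conjs) (auto simp: b intro!: wf_disjs wf_mem_fm wf_eqs_fm wf_disjoint_fm)
  moreover have "wf_fm 21 (13 + 4) (conjs [strong_fm 17 (block 3), mem_fm 0 (block 3),
        conjs [disjs [mem_fm 0 (block i), disjoint_fm (block i) (block 3)]. i \<leftarrow> [0..<3]]])"
    (is "wf_fm 21 (13 + 4) ?C")
    by (intro wf_conjs)
       (auto simp: b b3 intro!: wf_conjs wf_disjs wf_mem_fm wf_disjoint_fm wf_strong_fm)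
  then have "wf_fm 21 13 (Neg (exs 4 ?C))" unfolding wf_fm.simps by (intro wf_exs) simp_all
  ultimately have "wf_fm 21 (0 + 13) (conjs [?A, ?B, Neg (exs 4 ?C)])"
    by (simp only: conjs.simps wf_fm.simps) simp
  then show ?thesis
    unfolding localizable_fm_def wf_fm.simps by (intro wf_exs) simp_all
qed

text \<open>Repeating one element fills the surplus positions, so a block of fixed length can name
  every nonempty set up to that size.\<close>

lemma enumerate_finite:
  fixes a :: nat
  assumes "finite A" "A \<noteq> {}" "card A \<le> k"
  obtains g where "g ` {a..<a + k} = A"
proof -
  obtain h where h: "bij_betw h {0..<card A} A" using ex_bij_betw_nat_finite[OF assms(1)] by blast
  obtain x where x: "x \<in> A" using assms(2) by blast
  let ?g = "\<lambda>i. if i - a < card A then h (i - a) else x"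
  have "?g ` {a..<a + k} = A"
  proof
    show "?g ` {a..<a + k} \<subseteq> A" using x bij_betwE[OF h] by auto
    show "A \<subseteq> ?g ` {a..<a + k}"
    proof
      fix y assume "y \<in> A"
      then obtain i where "i < card A" "y = h i"
        using h unfolding bij_betw_def by (metis (no_types, lifting) atLeastLessThan_iff imageE)
      then show "y \<in> ?g ` {a..<a + k}"
        using assms(3) by (intro image_eqI[of _ _ "a + i"]) auto
    qed
  qed
  then show ?thesis by (rule that)
qed

lemma sat_localizable_fm:
  assumes "simple_graph {..<n} E" "subcubic {..<n} E"
  shows "sat n (\<lambda>u v. {u, v} \<in> E) 0 s localizable_fm \<longleftrightarrow> localizable {..<n} E"
proof -
  have graph: "subcubic_graph {..<n} E" using assms by unfold_locales
  interpret subcubic_graph "{..<n}" E by (fact graph)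
  define b where "b i = set (block i)" for i
  have b: "b i \<subseteq> {1..<13}" if "i < 3" for i using that by (auto simp: b_def block_def)
  \<comment> \<open>\<open>ok\<close> and \<open>ext\<close> are the hypotheses and the conclusion
    of \<open>localizable_iff\<close> read off an environment: \<open>t 0\<close> is
    \<open>v\<close>, and the image of \<open>b i\<close> under \<open>t\<close> is
    \<open>c i\<close>.\<close>
  define ok where "ok t \<longleftrightarrow> (\<forall>i<3. t 0 \<in> t ` b i \<or> strong (t ` b i)) \<and>
    (\<forall>i<3. \<forall>j<3. t 0 \<in> t ` b i \<or> t 0 \<in> t ` b j \<or> t ` b i = t ` b j \<or> t ` b i \<inter> t ` b j = {})"
    for t :: "nat \<Rightarrow> nat"
  define ext where "ext t \<longleftrightarrow> (\<exists>D. strong D \<and> t 0 \<in> D \<and> (\<forall>i<3. t 0 \<in> t ` b i \<or> t ` b i \<inter> D = {}))"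
    for t :: "nat \<Rightarrow> nat"
  let ?R = "\<lambda>u v. {u, v} \<in> E"
  let ?A = "conjs [disjs [mem_fm 0 (block i), strong_fm 13 (block i)]. i \<leftarrow> [0..<3]]"
  let ?B = "conjs [disjs [mem_fm 0 (block i), mem_fm 0 (block j), eqs_fm (block i) (block j),
    disjoint_fm (block i) (block j)]. i \<leftarrow> [0..<3], j \<leftarrow> [0..<3]]"
  let ?C = "exs 4 (conjs [strong_fm 17 (block 3), mem_fm 0 (block 3),
    conjs [disjs [mem_fm 0 (block i), disjoint_fm (block i) (block 3)]. i \<leftarrow> [0..<3]]])"
  have inner: "sat n ?R 13 t ?C \<longleftrightarrow> ext t" for t
  proof -
    have "sat n ?R 13 t ?C \<longleftrightarrow> (\<exists>t'. (\<forall>i. i < 13 \<or> 17 \<le> i \<longrightarrow> t' i = t i) \<and> (\<forall>i. 13 \<le> i \<and> i < 17 \<longrightarrow> t' i < n) \<and>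
      sat n ?R 17 t' (strong_fm 17 (block 3)) \<and> t' 0 \<in> t' ` {13..<17} \<and>
      (\<forall>i<3. t' 0 \<in> t' ` b i \<or> t' ` b i \<inter> t' ` {13..<17} = {}))"
      by (simp add: sat_exs sat_simps b_def set_block_3 ball_less)
    also have "\<dots> \<longleftrightarrow> (\<exists>t'. (\<forall>i. i < 13 \<or> 17 \<le> i \<longrightarrow> t' i = t i) \<and> (\<forall>i. 13 \<le> i \<and> i < 17 \<longrightarrow> t' i < n) \<and>
      strong (t' ` {13..<17}) \<and> t' 0 \<in> t' ` {13..<17} \<and>
      (\<forall>i<3. t' 0 \<in> t' ` b i \<or> t' ` b i \<inter> t' ` {13..<17} = {}))"
      by (intro ex_cong1 conj_cong refl) (subst sat_strong_fm[OF graph], auto simp: set_block_3)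
    also have "\<dots> \<longleftrightarrow> ext t"
    proof
      assume "\<exists>t'. (\<forall>i. i < 13 \<or> 17 \<le> i \<longrightarrow> t' i = t i) \<and> (\<forall>i. 13 \<le> i \<and> i < 17 \<longrightarrow> t' i < n) \<and>
        strong (t' ` {13..<17}) \<and> t' 0 \<in> t' ` {13..<17} \<and>
        (\<forall>i<3. t' 0 \<in> t' ` b i \<or> t' ` b i \<inter> t' ` {13..<17} = {})"
      then obtain t' where t': "\<forall>i. i < 13 \<or> 17 \<le> i \<longrightarrow> t' i = t i" "strong (t' ` {13..<17})"
        "t' 0 \<in> t' ` {13..<17}" "\<forall>i<3. t' 0 \<in> t' ` b i \<or> t' ` b i \<inter> t' ` {13..<17} = {}"
        by blast
      \<comment> \<open>The variables from 13 on are reserved for \<open>D\<close>, so choosing them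
        anew changes neither \<open>v\<close> nor the sets \<open>c i\<close>.\<close>
      have im: "t' ` b i = t ` b i" if "i < 3" for i
        using b[OF that] t'(1) by (intro image_cong) auto
      have "t' 0 = t 0" using t'(1) by simp
      with t' im show "ext t" unfolding ext_def by (intro exI[of _ "t' ` {13..<17}"]) auto
    next
      assume "ext t"
      then obtain D where D: "strong D" "t 0 \<in> D" "\<forall>i<3. t 0 \<in> t ` b i \<or> t ` b i \<inter> D = {}"
        unfolding ext_def by blast
      obtain g where g: "g ` {13..<13 + 4 :: nat} = D"
        by (rule enumerate_finite[OF strong_finite[OF D(1)] strong_nonempty[OF D(1)]
              card_strong[OF D(1)]])
      define t' where "t' i = (if 13 \<le> i \<and> i < 17 then g i else t i)" for i :: nat
      have "t' ` {13..<17} = g ` {13..<13 + 4}" by (intro image_cong) (auto simp: t'_def)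
      then have t'D: "t' ` {13..<17} = D" using g by simp
      have im: "t' ` b i = t ` b i" if "i < 3" for i
        using b[OF that] by (intro image_cong) (auto simp: t'_def)
      have "t' i < n" if "13 \<le> i \<and> i < 17" for i
        using t'D strong_subset_V[OF D(1)] that by fastforce
      moreover have "t' 0 = t 0" by (simp add: t'_def)
      moreover have "\<forall>i. i < 13 \<or> 17 \<le> i \<longrightarrow> t' i = t i" by (simp add: t'_def)
      ultimately show "\<exists>t'. (\<forall>i. i < 13 \<or> 17 \<le> i \<longrightarrow> t' i = t i) \<and> (\<forall>i. 13 \<le> i \<and> i < 17 \<longrightarrow> t' i < n) \<and>
        strong (t' ` {13..<17}) \<and> t' 0 \<in> t' ` {13..<17} \<and>
        (\<forall>i<3. t' 0 \<in> t' ` b i \<or> t' ` b i \<inter> t' ` {13..<17} = {})"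
        using D t'D im by (intro exI[of _ t']) simp
    qed
    finally show ?thesis .
  qed
  have hyps: "sat n ?R 13 t ?A \<and> sat n ?R 13 t ?B \<longleftrightarrow> ok t" if t: "\<And>i. i < 13 \<Longrightarrow> t i < n" for t
  proof -
    have "sat n ?R 13 t (strong_fm 13 (block i)) \<longleftrightarrow> strong (t ` b i)" if "i < 3" for i
      unfolding b_def
      by (rule sat_strong_fm[OF graph]) (use b[OF that] t in \<open>auto simp: b_def\<close>)
    then show ?thesis
      by (simp add: sat_simps ok_def b_def ball_less) blast
  qed
  have split: "sat n ?R 13 t (conjs [?A, ?B, Neg ?C]) \<longleftrightarrow> ok t \<and> \<not> ext t"
    if "\<forall>i<13. t i < n" for t
  proof -
    have ok: "sat n ?R 13 t ?A \<and> sat n ?R 13 t ?B \<longleftrightarrow> ok t"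
      by (rule hyps) (rule that[rule_format])
    have "sat n ?R 13 t (conjs [?A, ?B, Neg ?C]) \<longleftrightarrow>
        (sat n ?R 13 t ?A \<and> sat n ?R 13 t ?B) \<and> \<not> sat n ?R 13 t ?C"
      by (simp only: conjs.simps sat.simps order_refl simp_thms conj_assoc)
    then show ?thesis unfolding ok inner .
  qed
  have "sat n ?R 0 s localizable_fm \<longleftrightarrow>
      \<not> (\<exists>t. (\<forall>i. 13 \<le> i \<longrightarrow> t i = s i) \<and> (\<forall>i<13. t i < n) \<and> sat n ?R 13 t (conjs [?A, ?B, Neg ?C]))"
    unfolding localizable_fm_def sat.simps sat_exs by simp
  also have "\<dots> \<longleftrightarrow> \<not> (\<exists>t. (\<forall>i. 13 \<le> i \<longrightarrow> t i = s i) \<and> (\<forall>i<13. t i < n) \<and> ok t \<and> \<not> ext t)"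
    by (intro arg_cong[where f = Not] ex_cong1 conj_cong refl) (rule split)
  also have "\<dots> \<longleftrightarrow> localizable {..<n} E"
    unfolding localizable_iff
  proof (intro iffI ballI allI impI)
    fix v and c :: "nat \<Rightarrow> nat set"
    assume *: "\<not> (\<exists>t. (\<forall>i. 13 \<le> i \<longrightarrow> t i = s i) \<and> (\<forall>i<13. t i < n) \<and> ok t \<and> \<not> ext t)"
      and v: "v \<in> {..<n}" and c: "\<forall>i<3. c i \<subseteq> {..<n} \<and> c i \<noteq> {} \<and> card (c i) \<le> 4"
      "\<forall>i<3. v \<in> c i \<or> strong (c i)"
      "\<forall>i<3. \<forall>j<3. v \<in> c i \<or> v \<in> c j \<or> c i = c j \<or> c i \<inter> c j = {}"
    have "\<exists>g. i < 3 \<longrightarrow> g ` {4 * i + 1..<4 * i + 1 + 4} = c i" for i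
    proof (cases "i < 3")
      case True
      then have ci: "c i \<subseteq> {..<n}" "c i \<noteq> {}" "card (c i) \<le> 4" using c(1) by simp_all
      then have "finite (c i)" using finite_subset finite_lessThan by blast
      from enumerate_finite[OF this ci(2,3), of "4 * i + 1"] show ?thesis by metis
    qed simp
    then have "\<forall>i. \<exists>g. i < 3 \<longrightarrow> g ` {4 * i + 1..<4 * i + 1 + 4} = c i" ..
    from choice[OF this] obtain g
      where "\<forall>i. i < 3 \<longrightarrow> g i ` {4 * i + 1..<4 * i + 1 + 4} = c i" ..
    then have g: "g i ` {4 * i + 1..<4 * i + 1 + 4} = c i" if "i < 3" for i using that by simp
    \<comment> \<open>The variables 1 to 12 fall into blocks of four; variable \<open>i\<close>
      belongs to block \<open>(i - 1) div 4\<close>.\<close>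
    define t where "t i = (if i = 0 then v else if i < 13 then g ((i - 1) div 4) i else s i)" for i
    have tb: "t ` b i = c i" if i: "i < 3" for i
    proof -
      have "t ` b i = g i ` {4 * i + 1..<4 * i + 1 + 4}"
        unfolding b_def set_block
      proof (rule image_cong)
        fix x assume x: "x \<in> {4 * i + 1..<4 * i + 1 + 4}"
        then have "(x - 1) div 4 = i" by auto
        with x i show "t x = g i x" by (simp add: t_def)
      qed (simp add: add.commute)
      then show ?thesis using g[OF i] by simp
    qed
    have "t i < n" if "i < 13" for i
    proof (cases "i = 0")
      case False
      define j where "j = (i - 1) div 4"
      have "j < 3" "i \<in> b j" using that False by (auto simp: j_def b_def set_block)
      then have "t i \<in> c j" using tb[of j] by blast
      then show ?thesis using c(1) \<open>j < 3\<close> by auto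
    qed (use v in \<open>simp add: t_def\<close>)
    moreover have t0: "t 0 = v" by (simp add: t_def)
    moreover have "\<forall>i. 13 \<le> i \<longrightarrow> t i = s i" by (simp add: t_def)
    moreover have "ok t" using c(2,3) tb t0 by (simp add: ok_def)
    ultimately have "ext t" using * by blast
    then show "\<exists>D. strong D \<and> v \<in> D \<and> (\<forall>i<3. v \<in> c i \<or> c i \<inter> D = {})"
      using tb t0 by (simp add: ext_def)
  next
    assume loc: "\<forall>v\<in>{..<n}. \<forall>c :: nat \<Rightarrow> nat set.
     (\<forall>i<3. c i \<subseteq> {..<n} \<and> c i \<noteq> {} \<and> card (c i) \<le> 4) \<longrightarrow>
     (\<forall>i<3. v \<in> c i \<or> strong (c i)) \<longrightarrow>
     (\<forall>i<3. \<forall>j<3. v \<in> c i \<or> v \<in> c j \<or> c i = c j \<or> c i \<inter> c j = {}) \<longrightarrow>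
     (\<exists>D. strong D \<and> v \<in> D \<and> (\<forall>i<3. v \<in> c i \<or> c i \<inter> D = {}))"
    show "\<not> (\<exists>t. (\<forall>i. 13 \<le> i \<longrightarrow> t i = s i) \<and> (\<forall>i<13. t i < n) \<and> ok t \<and> \<not> ext t)"
    proof
      assume "\<exists>t. (\<forall>i. 13 \<le> i \<longrightarrow> t i = s i) \<and> (\<forall>i<13. t i < n) \<and> ok t \<and> \<not> ext t"
      then obtain t where t: "\<forall>i<13. t i < n" "ok t" "\<not> ext t" by blast
      have "t ` b i \<subseteq> {..<n} \<and> t ` b i \<noteq> {} \<and> card (t ` b i) \<le> 4" if "i < 3" for i
      proof (intro conjI)
        show "t ` b i \<subseteq> {..<n}" using b[OF that] t(1) by fastforce
        show "t ` b i \<noteq> {}" by (simp add: b_def set_block)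
        show "card (t ` b i) \<le> 4" by (rule order.trans[OF card_image_le]) (simp_all add: b_def set_block)
      qed
      then have "ext t"
        using loc[rule_format, of "t 0" "\<lambda>i. t ` b i"] t(1,2) unfolding ok_def ext_def by simp
      with t(3) show False by simp
    qed
  qed
  finally show ?thesis .
qed

theorem theorem6p5:
  shows "poly_time_solvable_on
           {(n, E). simple_graph {..<n} E \<and> subcubic {..<n} E}
           (\<lambda>(n, E). adjacency_string n E)
           (\<lambda>(n, E). localizable {..<n} E)"
  by (rule poly_time_first_order[OF wf_localizable_fm]) (simp add: sat_localizable_fm)

end
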